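(* Let $N\ge0$ be an integer, $\varepsilon_N\in\{\mathrm{fwd},\mathrm{bwd}\}$, and let $k_N\ge0$ be an integer with $k_N+N$ even; if $\varepsilon_N=\mathrm{fwd}$, assume $k_N\ge1$. Assume $M_N:=N-k_N\ge0$. Then $$\|\mu^{\varepsilon_N}_{k_N,N}-\rho^{\mathrm{ev}}\|_{\mathrm{TV}}\ll_q q^{-M_N/2}.$$ If $\varepsilon_N=\mathrm{bwd}$, then the sharper estimate $\|\mu^{\mathrm{bwd}}_{k_N,N}-\rho^{\mathrm{ev}}\|_{\mathrm{TV}}=O_q(q^{-M_N})$ holds.
   Context: Let $q$ be a prime power, $F=\mathbb F_q((t^{-1}))$, $\mathcal O=\mathbb F_q[[t^{-1}]]$, $\pi=t^{-1}$. $\mathcal T$ is the Bruhat--Tits tree of $\mathrm{PGL}_2(F)$: vertices are homothety classes $[L]$ of $\mathcal O$-lattices in $F^2$, adjacent if representatives can be chosen with $\pi L\subsetneq L'\subsetneq L$, $L/L'\simeq\mathbb F_q$; it is $(q+1)$-regular. Put $v_n=[\mathrm{diag}(t^n,1)]\cdot[\mathcal O^2]$. The quotient of $\mathcal T$ by $\mathrm{PGL}_2(\mathbb F_q[t])$ is a ray represented by $v_0-v_1-\cdots$, and the height $h(v)$ of a vertex is the $n\ge0$ for which $v$ lies in the orbit of $v_n$. All neighbors of a height-$0$ vertex have height $1$; a vertex of height $k\ge1$ has exactly one neighbor of height $k+1$ and exactly $q$ of height $k-1$. An oriented edge $e=(z_{-1},z_0)$ with $h(z_0)=k$ is forward (state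 $(\mathrm{fwd},k)$, $k\ge1$) if $h(z_{-1})=k-1$, backward (state $(\mathrm{bwd},k)$, $k\ge0$) if $h(z_{-1})=k+1$. $\mathrm{Desc}_N(e)$ is the set of terminal vertices $z_N$ of non-backtracking paths $z_{-1}\to z_0\to\cdots\to z_N$ ($q^N$ elements). $\mu^{\varepsilon}_{k,N}(j)$ is $q^{-N}$ times the number of vertices of height $j$ in $\mathrm{Desc}_N(e)$ for $e$ in state $(\varepsilon,k)$; this depends only on the state. $\rho^{\mathrm{ev}}$ on $2\mathbb Z_{\ge0}$: $\rho^{\mathrm{ev}}(0)=\frac{q-1}{q}$, $\rho^{\mathrm{ev}}(2m)=(q^2-1)q^{-2m-1}$ for $m\ge1$. For a signed measure on the height space, $\|\nu\|_{\mathrm{TV}}=\sum_j|\nu(j)|$. $A\ll_qB$ (and $O_q$) means $|A|\le C'B$ with $C'$ depending only on $q$. *)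

theory Defs
  imports
    "HOL-Analysis.Analysis"
    "HOL-Computational_Algebra.Formal_Laurent_Series"
begin

text \<open>
  The finite field with \<open>q\<close> elements is a type \<open>'a :: {field, finite}\<close> with \<open>q = CARD('a)\<close>.
  The local field \<open>F\<close> of Laurent series in \<open>1/t\<close> is \<open>'a fls\<close>: the formal variable \<open>fls_X\<close> plays
  the role of the uniformizer \<open>\<pi> = 1/t\<close>, so that \<open>t = fls_X_inv\<close>.
\<close>

definition ints_O :: "'a::{field,finite} fls set" where
  "ints_O = range fps_to_fls"

text \<open>The subring of polynomials in \<open>t\<close>, embedded in \<open>F\<close>.\<close>

definition polys_t :: "'a::{field,finite} fls set" where
  "polys_t = range (\<lambda>p :: 'a poly. poly (map_poly fls_const p) fls_X_inv)"

definition std_lattice :: "('a::{field,finite} fls ^ 2) set" where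
  "std_lattice = {x. \<forall>i. x $ i \<in> ints_O}"

text \<open>
  An \<open>O\<close>-lattice is the \<open>O\<close>-span of an \<open>F\<close>-basis of the plane; the basis is given by the columns
  of \<open>g\<close>.
\<close>

definition is_lattice :: "('a::{field,finite} fls ^ 2) set \<Rightarrow> bool" where
  "is_lattice L \<longleftrightarrow> (\<exists>g :: 'a fls ^ 2 ^ 2. invertible g \<and> L = (*v) g ` std_lattice)"

definition scale_set :: "'a::{field,finite} fls \<Rightarrow> ('a fls ^ 2) set \<Rightarrow> ('a fls ^ 2) set" where
  "scale_set c L = (\<lambda>x. c *s x) ` L"

type_synonym 'a vert = "('a fls ^ 2) set set"

definition homothety_class :: "('a::{field,finite} fls ^ 2) set \<Rightarrow> 'a vert" where
  "homothety_class L = {scale_set c L | c. c \<noteq> 0}"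

definition tree_vertices :: "'a::{field,finite} vert set" where
  "tree_vertices = {homothety_class L | L. is_lattice L}"

text \<open>
  \<open>L / L'\<close> is isomorphic, as an \<open>O\<close>-module, to the residue field: there is an \<open>O\<close>-linear
  surjection from \<open>L\<close> onto the residue field with kernel \<open>L'\<close>. An element \<open>a\<close> of \<open>O\<close> acts on the
  residue field through its constant coefficient.
\<close>

definition quotient_is_residue_field ::
    "('a::{field,finite} fls ^ 2) set \<Rightarrow> ('a fls ^ 2) set \<Rightarrow> bool" where
  "quotient_is_residue_field L L' \<longleftrightarrow>
     (\<exists>\<phi> :: 'a fls ^ 2 \<Rightarrow> 'a.
        (\<forall>x\<in>L. \<forall>y\<in>L. \<phi> (x + y) = \<phi> x + \<phi> y) \<and>
        (\<forall>a\<in>ints_O. \<forall>x\<in>L. \<phi> (a *s x) = fls_nth a 0 * \<phi> x) \<and>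
        \<phi> ` L = UNIV \<and> {x \<in> L. \<phi> x = 0} = L')"

definition tree_adj :: "'a::{field,finite} vert \<Rightarrow> 'a vert \<Rightarrow> bool" where
  "tree_adj V W \<longleftrightarrow> V \<in> tree_vertices \<and> W \<in> tree_vertices \<and>
     (\<exists>L\<in>V. \<exists>L'\<in>W. scale_set fls_X L \<subset> L' \<and> L' \<subset> L \<and> quotient_is_residue_field L L')"

definition act :: "'a::{field,finite} fls ^ 2 ^ 2 \<Rightarrow> 'a vert \<Rightarrow> 'a vert" where
  "act g V = (\<lambda>L. (*v) g ` L) ` V"

text \<open>
  Scalars act trivially on homothety classes, so orbits of the projective group over the
  polynomial ring are orbits of the following group.
\<close>

definition GL2_polys :: "('a::{field,finite} fls ^ 2 ^ 2) set" where
  "GL2_polys = {g. (\<forall>i j. g $ i $ j \<in> polys_t) \<and>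
     (\<exists>h. (\<forall>i j. h $ i $ j \<in> polys_t) \<and> g ** h = mat 1 \<and> h ** g = mat 1)}"

definition diag_t :: "nat \<Rightarrow> 'a::{field,finite} fls ^ 2 ^ 2" where
  "diag_t n = vector [vector [fls_X_inv ^ n, 0], vector [0, 1]]"

definition ray_vertex :: "nat \<Rightarrow> 'a::{field,finite} vert" where
  "ray_vertex n = act (diag_t n) (homothety_class std_lattice)"

definition height :: "'a::{field,finite} vert \<Rightarrow> nat" where
  "height V = (THE n. \<exists>g\<in>GL2_polys. V = act g (ray_vertex n))"

datatype direction = Fwd | Bwd

text \<open>An oriented edge is the pair of its initial and terminal vertices.\<close>

definition in_state ::
    "'a::{field,finite} vert \<times> 'a vert \<Rightarrow> direction \<Rightarrow> nat \<Rightarrow> bool" where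
  "in_state e \<epsilon> k \<longleftrightarrow> tree_adj (fst e) (snd e) \<and> height (snd e) = k \<and>
     (case \<epsilon> of
        Fwd \<Rightarrow> k \<ge> 1 \<and> height (fst e) = k - 1
      | Bwd \<Rightarrow> height (fst e) = k + 1)"

text \<open>
  The indexing of paths is shifted by one: \<open>z 0\<close> and \<open>z 1\<close> are the initial and terminal vertices
  of the starting edge, and \<open>z (N + 1)\<close> is the endpoint after \<open>N\<close> further steps.
\<close>

definition Desc :: "nat \<Rightarrow> 'a::{field,finite} vert \<times> 'a vert \<Rightarrow> 'a vert set" where
  "Desc N e = {z (N + 1) | z :: nat \<Rightarrow> 'a vert.
     z 0 = fst e \<and> z 1 = snd e \<and>
     (\<forall>i\<le>N. tree_adj (z i) (z (i + 1))) \<and> (\<forall>i<N. z i \<noteq> z (i + 2))}"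

text \<open>
  The common value, over all edges in state \<open>(\<epsilon>, k)\<close>, of the normalized number of descendants of
  height \<open>j\<close>. The first argument only records the field.
\<close>

definition mu ::
    "'a::{field,finite} itself \<Rightarrow> direction \<Rightarrow> nat \<Rightarrow> nat \<Rightarrow> nat \<Rightarrow> real" where
  "mu _ \<epsilon> k N j = (THE r. \<forall>e :: 'a vert \<times> 'a vert. in_state e \<epsilon> k \<longrightarrow>
     r = real (card {v \<in> Desc N e. height v = j}) / real CARD('a) ^ N)"

text \<open>Extended by zero to odd heights.\<close>

definition rho_ev :: "nat \<Rightarrow> nat \<Rightarrow> real" where
  "rho_ev q j =
     (if j = 0 then (real q - 1) / real q
      else if even j then ((real q)\<^sup>2 - 1) * real q powi (- int j - 1)
      else 0)"

text \<open>No factor \<open>1/2\<close>; extended-real valued, so that finiteness is part of any upper bound.\<close>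

definition tv_norm :: "(nat \<Rightarrow> real) \<Rightarrow> ennreal" where
  "tv_norm \<nu> = (\<Sum>j. ennreal \<bar>\<nu> j\<bar>)"

end

theory Submission
  imports Defs
begin

text \<open>
  The tree is viewed from one of its ends. Every vertex is the class of a lattice with basis
  \<open>(\<pi>\<^sup>n, 0)\<close>, \<open>(b, 1)\<close> and thus corresponds to the ball \<open>b + \<pi>\<^sup>n O\<close> in the field
  (\<open>vertex_is_ball\<close>, \<open>ball_eq_iff\<close>); its neighbours are the next larger ball around it, its parent,
  and the \<open>q\<close> next smaller balls inside it, its children (\<open>tree_adj_ball\<close>). A non-backtracking path
  goes to parents for a while and then only to children. Paths that separate never meet again
  (\<open>Desc_disjoint\<close>), and the descendants of an edge can be counted by summing over the next step.

  Invertible matrices over the polynomial ring move every ball to one of the balls \<open>t\<^sup>n O\<close>, and \<open>n\<close> is then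
  the height. There the parent has height \<open>n + 1\<close>, and polynomial translations move every child to
  \<open>t\<^bsup>n-1\<^esup> O\<close>; for \<open>n = 0\<close> exchanging the coordinates shows that the children have height \<open>1\<close>
  (\<open>nbrs_heights\<close>). Hence the height along a random path is a Markov chain on states, and the measures
  \<open>mu\<close> are its laws \<open>walk\<close> (\<open>mu_eq_walk\<close>).

  A forward path either goes on or turns, and the law after turning at once depends only on
  \<open>N - k\<close>, which is the time left on reaching height \<open>0\<close> or, with the opposite sign, the height
  at which the time runs out. Therefore the forward laws for \<open>(k + 1, N + 1)\<close> and \<open>(k, N)\<close> differ only
  by a dipole of mass \<open>q\<^bsup>-N-1\<^esup>\<close> at the two heights \<open>k + N + 2\<close> and \<open>k + N\<close> (\<open>walk_shift\<close>).
  For the law of \<open>M\<close> steps from height \<open>0\<close> this means that two more steps add a dipole of mass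
  \<open>q\<^bsup>-M-1\<^esup>\<close> at \<open>M + 2\<close> and \<open>M\<close> (\<open>walk_Bwd_step\<close>). For even \<open>M\<close> the sum telescopes to a law
  that equals \<open>rho_ev\<close> below \<open>M\<close> and vanishes above \<open>M\<close>, so its distance to \<open>rho_ev\<close> is a geometric
  tail of size \<open>q\<^bsup>-M\<^esup>\<close> (\<open>tv_walk_Bwd_0\<close>). A backward path from height \<open>k\<close> first spends \<open>k\<close>
  steps going down to height \<open>0\<close>; a forward law is reached from height \<open>1\<close> by adding dipoles whose
  masses form a geometric series of size \<open>q\<^bsup>-M\<^esup>\<close> (\<open>tv_walk_Fwd\<close>). So both directions satisfy
  the bound of order \<open>q\<^bsup>-M\<^esup>\<close> with \<open>M = N - k\<close>, and \<open>q\<^bsup>-M\<^esup> \<le> q\<^bsup>-M/2\<^esup>\<close>.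
\<close>

section \<open>Two-by-two matrices and integral series\<close>

definition mat2 :: "'b::zero \<Rightarrow> 'b \<Rightarrow> 'b \<Rightarrow> 'b \<Rightarrow> 'b ^ 2 ^ 2" where
  "mat2 a b c d = vector [vector [a, b], vector [c, d]]"

lemma mat2_nth [simp]:
  "mat2 a b c d $ 1 $ 1 = a" "mat2 a b c d $ 1 $ 2 = b"
  "mat2 a b c d $ 2 $ 1 = c" "mat2 a b c d $ 2 $ 2 = d"
  by (simp_all add: mat2_def)

lemma mat2_cases: obtains a b c d where "g = mat2 a b c d"
proof -
  have "g = mat2 (g $ 1 $ 1) (g $ 1 $ 2) (g $ 2 $ 1) (g $ 2 $ 2)"
    by (simp add: vec_eq_iff forall_2)
  with that show ?thesis by blast
qed

lemma mat2_eq_iff [simp]: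
  "mat2 a b c d = mat2 a' b' c' d' \<longleftrightarrow> a = a' \<and> b = b' \<and> c = c' \<and> d = d'"
  by (auto simp: vec_eq_iff forall_2)

lemma mat2_mult:
  fixes a :: "'b::semiring_1"
  shows "mat2 a b c d ** mat2 a' b' c' d' =
    mat2 (a * a' + b * c') (a * b' + b * d') (c * a' + d * c') (c * b' + d * d')"
  by (simp add: vec_eq_iff forall_2 matrix_matrix_mult_def sum_2)

lemma mat2_vec:
  fixes a :: "'b::semiring_1"
  shows "(mat2 a b c d *v x) $ 1 = a * x $ 1 + b * x $ 2"
    "(mat2 a b c d *v x) $ 2 = c * x $ 1 + d * x $ 2"
  by (simp_all add: matrix_vector_mult_def sum_2)

lemma mat_eq_mat2: "mat c = mat2 c 0 0 (c::'b::semiring_1)"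
  by (simp add: vec_eq_iff forall_2 mat_def)

lemma det_mat2: "det (mat2 a b c d) = a * d - b * (c::'b::comm_ring_1)"
  by (simp add: det_2)

lemma mat2_inverse:
  fixes a :: "'b::field"
  assumes "a * d - b * c \<noteq> 0"
  defines "D \<equiv> a * d - b * c"
  shows "mat2 a b c d ** mat2 (d / D) (- b / D) (- c / D) (a / D) = mat 1"
    "mat2 (d / D) (- b / D) (- c / D) (a / D) ** mat2 a b c d = mat 1"
  using assms by (simp_all add: mat2_mult mat_eq_mat2 divide_simps)

text \<open>
  Homothety is multiplication by a scalar matrix, so that both homothety and the group action become
  products of matrices; scalars can then be moved past everything else.
\<close>

lemma mat_commute:
  fixes g :: "'b::comm_semiring_1 ^ 2 ^ 2"
  shows "mat c ** g = g ** mat c"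
  by (cases g rule: mat2_cases) (simp add: mat_eq_mat2 mat2_mult mult.commute)

lemma mat_mult_mat: "mat c ** mat d = (mat (c * d) :: 'b::semiring_1 ^ 2 ^ 2)"
  by (simp add: mat_eq_mat2 mat2_mult)

lemma mat_vec: "mat c *v x = c *s (x :: 'b::semiring_1 ^ 2)"
  by (simp add: mat_eq_mat2 vec_eq_iff forall_2 mat2_vec)

lemma invertible_mult:
  fixes g h :: "'b::field ^ 2 ^ 2"
  shows "invertible g \<Longrightarrow> invertible h \<Longrightarrow> invertible (g ** h)"
  by (simp add: invertible_det_nz det_mul)

lemma invertible_mat: "c \<noteq> 0 \<Longrightarrow> invertible (mat c :: 'b::field^2^2)"
  by (simp add: invertible_det_nz mat_eq_mat2 det_mat2)

lemma ints_O_iff: "x \<in> ints_O \<longleftrightarrow> 0 \<le> fls_subdegree x"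
proof
  assume "0 \<le> fls_subdegree x"
  then show "x \<in> ints_O" unfolding ints_O_def by (metis fls_regpart_to_fls_trivial rangeI)
qed (auto simp: ints_O_def fls_subdegree_fls_to_fps_gt0)

lemma ints_O_iff_nth: "x \<in> ints_O \<longleftrightarrow> (\<forall>k<0. fls_nth x k = 0)"
  by (auto simp: ints_O_iff intro: fls_subdegree_ge0I)

lemma ints_O_closed [simp, intro]:
  "0 \<in> ints_O" "1 \<in> ints_O" "fls_X \<in> ints_O" "fls_const a \<in> ints_O"
  "x \<in> ints_O \<Longrightarrow> y \<in> ints_O \<Longrightarrow> x + y \<in> ints_O"
  "x \<in> ints_O \<Longrightarrow> y \<in> ints_O \<Longrightarrow> x - y \<in> ints_O"
  "x \<in> ints_O \<Longrightarrow> - x \<in> ints_O"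
  "x \<in> ints_O \<Longrightarrow> y \<in> ints_O \<Longrightarrow> x * y \<in> ints_O"
proof -
  show "x \<in> ints_O \<Longrightarrow> y \<in> ints_O \<Longrightarrow> x * y \<in> ints_O"
    by (cases "x = 0 \<or> y = 0") (auto simp: ints_O_iff)
qed (simp_all add: ints_O_iff_nth)

lemma ints_O_divide_unit:
  "x \<in> ints_O \<Longrightarrow> fls_subdegree u = 0 \<Longrightarrow> u \<noteq> 0 \<Longrightarrow> x / u \<in> ints_O"
  by (cases "x = 0") (auto simp: ints_O_iff fls_divide_subdegree)

lemma std_lattice_iff: "x \<in> std_lattice \<longleftrightarrow> x $ 1 \<in> ints_O \<and> x $ 2 \<in> ints_O"
  by (simp add: std_lattice_def forall_2)

section \<open>Lattices and vertices given by matrices\<close>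

definition lattice_of :: "'a::{field,finite} fls ^ 2 ^ 2 \<Rightarrow> ('a fls ^ 2) set" where
  "lattice_of g = (*v) g ` std_lattice"

lemma lattice_of_mult: "(*v) h ` lattice_of g = lattice_of (h ** g)"
  by (simp add: lattice_of_def image_image matrix_vector_mul_assoc)

lemma lattice_of_1 [simp]: "lattice_of (mat 1) = std_lattice"
  by (simp add: lattice_of_def)

lemma scale_set_lattice_of: "scale_set c (lattice_of g) = lattice_of (mat c ** g)"
  by (simp add: scale_set_def mat_vec flip: lattice_of_mult)

lemma lattice_of_subset_std:
  assumes "a \<in> ints_O" "b \<in> ints_O" "c \<in> ints_O" "d \<in> ints_O"
  shows "lattice_of (mat2 a b c d) \<subseteq> std_lattice"
  using assms by (auto simp: lattice_of_def std_lattice_iff mat2_vec)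

text \<open>
  By Cramer's rule a matrix over \<open>O\<close> whose determinant is a unit has an inverse over \<open>O\<close>, hence
  stabilizes the standard lattice.
\<close>

lemma lattice_of_unimodular:
  assumes "a \<in> ints_O" "b \<in> ints_O" "c \<in> ints_O" "d \<in> ints_O"
    and D: "a * d - b * c \<noteq> 0" "fls_subdegree (a * d - b * c) = 0"
  shows "lattice_of (mat2 a b c d) = std_lattice"
proof
  let ?D = "a * d - b * c" and ?g = "mat2 a b c d"
  let ?h = "mat2 (d / ?D) (- b / ?D) (- c / ?D) (a / ?D)"
  have "lattice_of ?h \<subseteq> std_lattice"
    using assms by (intro lattice_of_subset_std ints_O_divide_unit) auto
  then have "(*v) ?g ` lattice_of ?h \<subseteq> lattice_of ?g" unfolding lattice_of_def by blast
  moreover have "?g ** ?h = mat 1" using D(1) by (rule mat2_inverse)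
  ultimately show "std_lattice \<subseteq> lattice_of ?g"
    by (simp only: lattice_of_mult lattice_of_1)
qed (use assms in \<open>simp add: lattice_of_subset_std\<close>)

lemma lattice_of_eq_std_entries:
  assumes "lattice_of (mat2 a b c d) \<subseteq> std_lattice"
  shows "a \<in> ints_O" "b \<in> ints_O" "c \<in> ints_O" "d \<in> ints_O"
proof -
  have "mat2 a b c d *v vector [1, 0] \<in> std_lattice" "mat2 a b c d *v vector [0, 1] \<in> std_lattice"
    using assms by (auto simp: lattice_of_def std_lattice_iff image_subset_iff)
  then show "a \<in> ints_O" "b \<in> ints_O" "c \<in> ints_O" "d \<in> ints_O"
    by (simp_all add: std_lattice_iff mat2_vec)
qed

text \<open>
  The converse: the base change between two bases of the same lattice is integral in both directions,
  so the valuations of its determinant and of the inverse determinant are nonnegative with sum zero.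
\<close>

lemma lattice_of_eqE:
  assumes "invertible g" "invertible h" "lattice_of g = lattice_of h"
  obtains a b c d where "g = h ** mat2 a b c d"
    "a \<in> ints_O" "b \<in> ints_O" "c \<in> ints_O" "d \<in> ints_O"
    "a * d - b * c \<noteq> 0" "fls_subdegree (a * d - b * c) = 0"
proof -
  obtain g' h' where inv: "g ** g' = mat 1" "g' ** g = mat 1" "h ** h' = mat 1" "h' ** h = mat 1"
    using assms by (auto simp: invertible_def)
  obtain a b c d where K: "h' ** g = mat2 a b c d" by (rule mat2_cases)
  obtain a' b' c' d' where K': "g' ** h = mat2 a' b' c' d'" by (rule mat2_cases)
  have "lattice_of (h' ** g) = std_lattice" "lattice_of (g' ** h) = std_lattice"
    using inv assms(3) lattice_of_mult[of h' g] lattice_of_mult[of h' h]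
      lattice_of_mult[of g' g] lattice_of_mult[of g' h] by auto
  then have ints: "a \<in> ints_O" "b \<in> ints_O" "c \<in> ints_O" "d \<in> ints_O"
    "a' \<in> ints_O" "b' \<in> ints_O" "c' \<in> ints_O" "d' \<in> ints_O"
    unfolding K K' using lattice_of_eq_std_entries[of a b c d] lattice_of_eq_std_entries[of a' b' c' d']
    by auto
  have "(h' ** g) ** (g' ** h) = mat 1"
    using inv by (metis matrix_mul_assoc matrix_mul_lid)
  then have "det (h' ** g) * det (g' ** h) = 1"
    by (simp flip: det_mul)
  then have D: "(a * d - b * c) * (a' * d' - b' * c') = 1"
    by (simp only: K K' det_mat2)
  then have nz: "a * d - b * c \<noteq> 0" "a' * d' - b' * c' \<noteq> 0" by auto
  have "fls_subdegree (a * d - b * c) + fls_subdegree (a' * d' - b' * c') = 0"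
    using fls_subdegree_mult[OF nz] D by simp
  moreover have "a * d - b * c \<in> ints_O" "a' * d' - b' * c' \<in> ints_O" using ints by auto
  ultimately have "fls_subdegree (a * d - b * c) = 0" by (simp add: ints_O_iff)
  moreover have "g = h ** mat2 a b c d"
    using inv by (metis K matrix_mul_assoc matrix_mul_lid)
  ultimately show ?thesis using that ints nz by blast
qed

definition vtx :: "'a::{field,finite} fls ^ 2 ^ 2 \<Rightarrow> 'a vert" where
  "vtx g = homothety_class (lattice_of g)"

lemma vtx_alt: "vtx g = {lattice_of (mat c ** g) | c. c \<noteq> 0}"
  by (simp add: vtx_def homothety_class_def scale_set_lattice_of)

lemma act_vtx: "act h (vtx g) = vtx (h ** g)"
proof -
  have *: "h ** (mat c ** g) = mat c ** (h ** g)" for c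
    by (metis mat_commute matrix_mul_assoc)
  show ?thesis unfolding act_def vtx_alt
    by (simp add: lattice_of_mult * setcompr_eq_image image_image)
qed

lemma tree_vertices_eq: "tree_vertices = {vtx g | g. invertible g}"
  by (auto simp: tree_vertices_def is_lattice_def vtx_def lattice_of_def)

lemma vtx_eqI:
  assumes "c \<noteq> 0" "lattice_of (mat c ** g) = lattice_of h"
  shows "vtx g = vtx h"
proof -
  have 1: "lattice_of (mat e ** h) = lattice_of (mat (e * c) ** g)" for e
    using assms(2) by (metis lattice_of_mult mat_mult_mat matrix_mul_assoc)
  have 2: "lattice_of (mat e ** g) = lattice_of (mat (e / c) ** h)" for e
    using 1[of "e / c"] assms(1) by simp
  have "vtx g \<subseteq> vtx h" unfolding vtx_alt
    using 2 by clarify (metis assms(1) divide_eq_0_iff)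
  moreover have "vtx h \<subseteq> vtx g" unfolding vtx_alt 1 using assms(1) by auto
  ultimately show ?thesis by blast
qed

lemma vtx_mult_unimodular:
  assumes "a \<in> ints_O" "b \<in> ints_O" "c \<in> ints_O" "d \<in> ints_O"
    "a * d - b * c \<noteq> 0" "fls_subdegree (a * d - b * c) = 0"
  shows "vtx (g ** mat2 a b c d) = vtx g"
proof -
  have "lattice_of (g ** mat2 a b c d) = (*v) g ` lattice_of (mat2 a b c d)"
    by (rule lattice_of_mult[symmetric])
  also have "\<dots> = lattice_of g"
    by (simp only: lattice_of_unimodular[OF assms] lattice_of_def[of g])
  finally show ?thesis by (simp add: vtx_def)
qed

lemma vtx_scale: "c \<noteq> 0 \<Longrightarrow> vtx (mat c ** g) = vtx g"
  by (rule vtx_eqI[OF _ refl, symmetric])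

text \<open>
  Together with \<open>vtx_scale\<close> and \<open>vtx_mult_unimodular\<close> this identifies the vertices with the cosets of
  the general linear group over the field modulo scalars and invertible integral matrices.
\<close>

lemma vtx_eqE:
  assumes "invertible g" "invertible h" "vtx g = vtx h"
  obtains e a b c d where "e \<noteq> 0" "g = mat e ** (h ** mat2 a b c d)"
    "a \<in> ints_O" "b \<in> ints_O" "c \<in> ints_O" "d \<in> ints_O"
    "a * d - b * c \<noteq> 0" "fls_subdegree (a * d - b * c) = 0"
proof -
  have "lattice_of g \<in> vtx g"
    unfolding vtx_alt by (rule CollectI, rule exI[of _ 1], simp)
  then have "lattice_of g \<in> vtx h" using assms(3) by simp
  then obtain e where e: "e \<noteq> 0" "lattice_of g = lattice_of (mat e ** h)"
    unfolding vtx_alt mem_Collect_eq by (elim exE conjE)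
  have "invertible (mat e ** h)"
    using e assms(2) by (intro invertible_mult invertible_mat)
  then obtain a b c d where "g = (mat e ** h) ** mat2 a b c d"
    "a \<in> ints_O" "b \<in> ints_O" "c \<in> ints_O" "d \<in> ints_O"
    "a * d - b * c \<noteq> 0" "fls_subdegree (a * d - b * c) = 0"
    using lattice_of_eqE[OF assms(1) _ e(2)] by blast
  then show ?thesis using that[OF e(1)] by (simp add: matrix_mul_assoc)
qed

section \<open>Vertices as balls\<close>

definition pow_pi :: "int \<Rightarrow> 'a::field fls" where "pow_pi n = fls_X powi n"

lemma pow_pi_simps [simp]:
  "pow_pi n \<noteq> 0" "fls_subdegree (pow_pi n) = n" "pow_pi 0 = 1" "pow_pi 1 = fls_X"
  by (simp_all add: pow_pi_def fls_X_conv_shift_1)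

lemma pow_pi_uminus [simp]:
  "pow_pi (- 1) = fls_X_inv" "pow_pi (- int m) = fls_X_inv ^ m"
  by (simp_all add: pow_pi_def power_int_minus fls_inverse_X del: fls_X_power_int flip: power_inverse)

lemma pow_pi_add: "pow_pi (m + n) = pow_pi m * pow_pi n"
  unfolding pow_pi_def by (rule power_int_add) simp

lemma pow_pi_diff: "pow_pi (m - n) = pow_pi m / pow_pi n"
  unfolding pow_pi_def by (rule power_int_diff) simp

text \<open>
  The columns \<open>(\<pi>\<^sup>n, 0)\<close> and \<open>(b, 1)\<close> depend, up to a base change over \<open>O\<close>, only on the ball
  \<open>b + \<pi>\<^sup>n O\<close> in the field. The vertices are in this way the balls of the field, and the order by
  inclusion displays the tree as seen from the end at infinity.
\<close>

definition ball_mat :: "'a::field fls \<Rightarrow> int \<Rightarrow> 'a fls ^ 2 ^ 2" where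
  "ball_mat b n = mat2 (pow_pi n) b 0 1"

definition ball_vtx :: "'a::{field,finite} fls \<Rightarrow> int \<Rightarrow> 'a vert" where
  "ball_vtx b n = vtx (ball_mat b n)"

lemma invertible_ball_mat: "invertible (ball_mat b n)"
  by (simp add: invertible_det_nz ball_mat_def det_mat2)

lemma ball_mat_mult: "ball_mat b n ** ball_mat c m = ball_mat (b + c * pow_pi n) (n + m)"
  by (simp add: ball_mat_def mat2_mult pow_pi_add mult.commute add.commute)

lemma pow_pi_dvd_iff: "x / pow_pi n \<in> ints_O \<longleftrightarrow> x = 0 \<or> n \<le> fls_subdegree x"
  by (cases "x = 0") (auto simp: ints_O_iff fls_divide_subdegree)

lemma ball_eq_iff:
  "ball_vtx b n = ball_vtx b' n' \<longleftrightarrow> n = n' \<and> (b - b') / pow_pi n \<in> ints_O"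
proof
  assume "ball_vtx b n = ball_vtx b' n'"
  then have "vtx (ball_mat b n) = vtx (ball_mat b' n')" by (simp only: ball_vtx_def)
  then obtain e k l m p where e: "e \<noteq> 0" and
    eq: "ball_mat b n = mat e ** (ball_mat b' n' ** mat2 k l m p)" and
    ints: "k \<in> ints_O" "l \<in> ints_O" "m \<in> ints_O" "p \<in> ints_O" and
    nz: "k * p - l * m \<noteq> 0" and u: "fls_subdegree (k * p - l * m) = 0"
    by (rule vtx_eqE[OF invertible_ball_mat invertible_ball_mat])
  from eq e have m: "m = 0" and 1: "e * p = 1" and 2: "pow_pi n = e * (pow_pi n' * k)"
     and 3: "b = e * (pow_pi n' * l + b' * p)"
    by (simp_all add: ball_mat_def mat_eq_mat2 mat2_mult)
  from nz m have "k \<noteq> 0" "p \<noteq> 0" by auto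
  with u m have "fls_subdegree k + fls_subdegree p = 0" by simp
  with ints have k: "fls_subdegree k = 0" and p: "fls_subdegree p = 0" by (simp_all add: ints_O_iff)
  have "fls_subdegree e + fls_subdegree p = 0"
    using 1 fls_subdegree_mult[OF e \<open>p \<noteq> 0\<close>] by simp
  then have "fls_subdegree e = 0" using p by simp
  moreover have "n = fls_subdegree (e * (pow_pi n' * k))"
    by (simp flip: 2)
  ultimately have n: "n = n'" using e \<open>k \<noteq> 0\<close> k by simp
  have "b - b' = e * l * pow_pi n"
    using 3 1 n by (simp add: algebra_simps)
  then have "(b - b') / pow_pi n = e * l" by simp
  moreover have "e \<in> ints_O" using \<open>fls_subdegree e = 0\<close> by (simp add: ints_O_iff)
  ultimately show "n = n' \<and> (b - b') / pow_pi n \<in> ints_O" using n ints by auto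
next
  assume *: "n = n' \<and> (b - b') / pow_pi n \<in> ints_O"
  then have "ball_mat b n = ball_mat b' n' ** mat2 1 ((b - b') / pow_pi n) 0 1"
    by (simp add: ball_mat_def mat2_mult)
  then show "ball_vtx b n = ball_vtx b' n'"
    unfolding ball_vtx_def
    by (simp only:) (rule vtx_mult_unimodular, use * in auto)
qed

text \<open>
  Iwasawa decomposition: column operations over \<open>O\<close> clear the entry of larger valuation in the bottom
  row, and a homothety makes the other one equal to \<open>1\<close>.
\<close>

lemma vertex_is_ball:
  assumes "V \<in> tree_vertices" obtains b n where "V = ball_vtx b n"
proof -
  have red: "\<exists>x n. vtx (mat2 a b c d) = ball_vtx x n"
    if nz: "a * d - b * c \<noteq> 0" and d: "d \<noteq> 0" and cd: "c / d \<in> ints_O"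
    for a b c d :: "'a fls"
  proof -
    \<comment> \<open>\<open>u\<close> is what remains of the determinant after the homothety and the power of \<open>\<pi>\<close>.\<close>
    define n where "n = fls_subdegree ((a * d - b * c) / d\<^sup>2)"
    define u where "u = (a * d - b * c) / d\<^sup>2 / pow_pi n"
    have u: "fls_subdegree u = 0" "u \<noteq> 0"
      using nz d by (simp_all add: fls_divide_subdegree u_def n_def)
    have "d * pow_pi n * u * d = a * d - b * c"
      using d by (simp add: u_def power2_eq_square)
    then have "a = d * (pow_pi n * u + b / d * (c / d))"
      using d by (simp add: field_simps)
    then have "mat2 a b c d = mat d ** (ball_mat (b / d) n ** mat2 u 0 (c / d) 1)"
      using d by (simp add: ball_mat_def mat_eq_mat2 mat2_mult)
    then have "vtx (mat2 a b c d) = vtx (ball_mat (b / d) n ** mat2 u 0 (c / d) 1)"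
      using d by (simp only: vtx_scale not_False_eq_True)
    also have "\<dots> = ball_vtx (b / d) n"
      unfolding ball_vtx_def by (rule vtx_mult_unimodular) (use u cd in \<open>auto simp: ints_O_iff\<close>)
    finally have "vtx (mat2 a b c d) = ball_vtx (b / d) n" .
    then show ?thesis by (intro exI)
  qed
  obtain g where g: "V = vtx g" "invertible g" using assms by (auto simp: tree_vertices_eq)
  obtain a b c d where abcd: "g = mat2 a b c d" by (rule mat2_cases)
  have nz: "a * d - b * c \<noteq> 0" using g(2) by (simp add: abcd invertible_det_nz det_mat2)
  have sw: "vtx (mat2 a b c d) = vtx (mat2 b a d c)"
    using vtx_mult_unimodular[of 0 1 1 0 "mat2 a b c d"] by (auto simp: mat2_mult)
  have "\<exists>x n. vtx (mat2 a b c d) = ball_vtx x n"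
  proof (cases "d \<noteq> 0 \<and> c / d \<in> ints_O")
    case True then show ?thesis using red[OF nz] by simp
  next
    case False
    then have c: "c \<noteq> 0" "d / c \<in> ints_O"
      using nz by (cases "c = 0"; cases "d = 0"; simp add: ints_O_iff fls_divide_subdegree)+
    have "b * c - a * d \<noteq> 0" using nz by simp
    then show ?thesis unfolding sw using c by (rule red)
  qed
  then show ?thesis using that unfolding g(1) abcd by (elim exE)
qed

lemma ball_in_tree [simp]: "ball_vtx b n \<in> tree_vertices"
  unfolding tree_vertices_eq ball_vtx_def
  by (intro CollectI exI conjI, rule refl, rule invertible_ball_mat)

lemma invertibleE:
  assumes "invertible (g :: 'b::field ^ 2 ^ 2)"
  obtains h where "g ** h = mat 1" "h ** g = mat 1" "invertible h"
  using assms unfolding invertible_def by blast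

lemma act_act_inverse:
  assumes "V \<in> tree_vertices" "h ** g = mat 1"
  shows "act h (act g V) = V"
proof -
  obtain k where "V = vtx k" using assms(1) unfolding tree_vertices_eq by (elim CollectE exE conjE)
  then show ?thesis using assms(2) by (simp add: act_vtx matrix_mul_assoc)
qed

lemma act_in_tree:
  assumes "V \<in> tree_vertices" "invertible g" shows "act g V \<in> tree_vertices"
proof -
  obtain k where k: "V = vtx k" "invertible k"
    using assms(1) unfolding tree_vertices_eq by (elim CollectE exE conjE)
  show ?thesis unfolding k(1) act_vtx tree_vertices_eq
    by (intro CollectI exI conjI, rule refl) (intro invertible_mult assms k)
qed

lemma tree_adj_act:
  assumes g: "invertible g" and adj: "tree_adj V W"
  shows "tree_adj (act g V) (act g W)"
proof -
  obtain h where h: "h ** g = mat 1" using g by (rule invertibleE)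
  have hg: "h *v (g *v x) = x" for x by (simp add: matrix_vector_mul_assoc h)
  have inj: "inj ((*v) g)" by (metis hg injI)
  obtain L L' \<phi> where L: "L \<in> V" "L' \<in> W" "scale_set fls_X L \<subset> L'" "L' \<subset> L"
    and add: "\<forall>x\<in>L. \<forall>y\<in>L. \<phi> (x + y) = \<phi> x + \<phi> y"
    and mult: "\<forall>a\<in>ints_O. \<forall>x\<in>L. \<phi> (a *s x) = fls_nth a 0 * \<phi> x"
    and onto: "\<phi> ` L = UNIV" and ker: "{x \<in> L. \<phi> x = 0} = L'"
    using adj unfolding tree_adj_def quotient_is_residue_field_def by (elim conjE bexE exE)
  let ?g = "(`) ((*v) g)"
  have scale: "scale_set c (?g X) = ?g (scale_set c X)" for c X
    by (simp add: scale_set_def image_image vector_scalar_commute)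
  have mono: "X \<subset> Y \<Longrightarrow> ?g X \<subset> ?g Y" for X Y
    using inj by (simp add: inj_image_subset_iff psubset_eq inj_image_eq_iff)
  have "quotient_is_residue_field (?g L) (?g L')"
    unfolding quotient_is_residue_field_def
  proof (intro exI[of _ "\<lambda>x. \<phi> (h *v x)"] conjI)
    show "\<forall>x\<in>?g L. \<forall>y\<in>?g L. \<phi> (h *v (x + y)) = \<phi> (h *v x) + \<phi> (h *v y)"
      using add by (auto simp: hg matrix_vector_right_distrib)
    show "\<forall>a\<in>ints_O. \<forall>x\<in>?g L. \<phi> (h *v (a *s x)) = fls_nth a 0 * \<phi> (h *v x)"
      using mult by (auto simp: hg vector_scalar_commute)
    show "(\<lambda>x. \<phi> (h *v x)) ` ?g L = UNIV"
      using onto by (simp add: image_image hg)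
    show "{x \<in> ?g L. \<phi> (h *v x) = 0} = ?g L'"
      unfolding ker[symmetric] by (auto simp: hg)
  qed
  moreover have "scale_set fls_X (?g L) \<subset> ?g L'" "?g L' \<subset> ?g L"
    using L mono by (simp_all add: scale)
  moreover have "?g L \<in> act g V" "?g L' \<in> act g W" using L by (simp_all add: act_def)
  moreover have "act g V \<in> tree_vertices" "act g W \<in> tree_vertices"
    using adj act_in_tree[OF _ g] by (simp_all add: tree_adj_def)
  ultimately show ?thesis
    unfolding tree_adj_def by (intro conjI bexI[of _ "?g L"] bexI[of _ "?g L'"])
qed

section \<open>Adjacency of balls\<close>

lemma ints_O_nth_mult:
  assumes "x \<in> ints_O" "y \<in> ints_O"
  shows "fls_nth (x * y) 0 = fls_nth x 0 * fls_nth y 0"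
  using assms by (auto simp: ints_O_def simp flip: fls_times_fps_to_fls)

lemma ints_O_nth_0_iff: "x \<in> ints_O \<Longrightarrow> fls_nth x 0 = 0 \<longleftrightarrow> (\<exists>y\<in>ints_O. x = fls_X * y)"
proof
  assume x: "x \<in> ints_O" "fls_nth x 0 = 0"
  have "x / fls_X \<in> ints_O"
  proof (cases "x = 0")
    case False
    then have "fls_subdegree x \<noteq> 0" using x(2) nth_fls_subdegree_nonzero by metis
    then show ?thesis using x(1) False by (simp add: ints_O_iff fls_divide_subdegree)
  qed auto
  then show "\<exists>y\<in>ints_O. x = fls_X * y" by (intro bexI[of _ "x / fls_X"]) (simp add: fls_X_times_conv_shift)
next
  assume "\<exists>y\<in>ints_O. x = fls_X * y"
  then show "fls_nth x 0 = 0" by (auto simp: ints_O_nth_mult)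
qed

text \<open>
  The kernel of the linear form with coefficients \<open>(\<alpha>, \<beta>)\<close> on the reduction of the standard lattice.
  As the form varies over the projective line of the residue field, these are exactly the sublattices
  that represent the neighbours of the standard vertex.
\<close>

definition residue_kernel :: "'a::{field,finite} \<Rightarrow> 'a \<Rightarrow> ('a fls ^ 2) set" where
  "residue_kernel \<alpha> \<beta> = {x \<in> std_lattice. \<alpha> * fls_nth (x $ 1) 0 + \<beta> * fls_nth (x $ 2) 0 = 0}"

lemma vector_2_eqI: "x $ 1 = y $ 1 \<Longrightarrow> x $ 2 = y $ 2 \<Longrightarrow> x = (y :: 'b ^ 2)"
  by (simp add: vec_eq_iff forall_2)

lemma lattice_of_ball_mat_1:
  assumes "\<alpha> \<noteq> 0" "\<alpha> * \<gamma> + \<beta> = 0"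
  shows "lattice_of (ball_mat (fls_const \<gamma>) 1) = residue_kernel \<alpha> \<beta>"
proof (intro equalityI subsetI)
  fix x assume "x \<in> lattice_of (ball_mat (fls_const \<gamma>) 1)"
  then obtain y :: "'a fls ^ 2" where y: "y $ 1 \<in> ints_O" "y $ 2 \<in> ints_O"
    and x: "x $ 1 = fls_X * y $ 1 + fls_const \<gamma> * y $ 2" "x $ 2 = y $ 2"
    by (auto simp: lattice_of_def std_lattice_iff ball_mat_def mat2_vec)
  have "fls_nth (x $ 1) 0 = \<gamma> * fls_nth (y $ 2) 0"
    using y by (simp add: x ints_O_nth_mult)
  moreover have "\<alpha> * (\<gamma> * z) + \<beta> * z = 0" for z
    using assms(2) by (metis mult.assoc distrib_right mult_zero_left)
  ultimately show "x \<in> residue_kernel \<alpha> \<beta>"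
    using x y by (auto simp: residue_kernel_def std_lattice_iff)
next
  fix x assume "x \<in> residue_kernel \<alpha> \<beta>"
  then have O: "x $ 1 \<in> ints_O" "x $ 2 \<in> ints_O"
    and 0: "\<alpha> * fls_nth (x $ 1) 0 + \<beta> * fls_nth (x $ 2) 0 = 0"
    by (auto simp: residue_kernel_def std_lattice_iff)
  have "\<beta> = - (\<alpha> * \<gamma>)" using assms(2) by (simp add: eq_neg_iff_add_eq_0 add.commute)
  then have "\<alpha> * (fls_nth (x $ 1) 0 - \<gamma> * fls_nth (x $ 2) 0) = 0" using 0 by (simp add: algebra_simps)
  then have "fls_nth (x $ 1 - fls_const \<gamma> * x $ 2) 0 = 0" using assms(1) by simp
  then obtain z where z: "z \<in> ints_O" "x $ 1 - fls_const \<gamma> * x $ 2 = fls_X * z"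
    using ints_O_nth_0_iff[of "x $ 1 - fls_const \<gamma> * x $ 2"] O by auto
  have "x = ball_mat (fls_const \<gamma>) 1 *v vector [z, x $ 2]"
    using z(2) by (intro vector_2_eqI) (simp_all add: ball_mat_def mat2_vec algebra_simps)
  moreover have "vector [z, x $ 2] \<in> std_lattice" using z O by (simp add: std_lattice_iff)
  ultimately show "x \<in> lattice_of (ball_mat (fls_const \<gamma>) 1)" unfolding lattice_of_def by (rule image_eqI)
qed

lemma lattice_of_ball_mat_minus_1:
  assumes "\<beta> \<noteq> 0"
  shows "lattice_of (mat fls_X ** ball_mat 0 (- 1)) = residue_kernel 0 \<beta>"
proof -
  have m: "mat fls_X ** ball_mat 0 (- 1) = mat2 1 0 0 (fls_X :: 'a fls)"
    by (simp add: mat_eq_mat2 ball_mat_def mat2_mult flip: fls_inverse_X)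
  show ?thesis unfolding m
  proof (intro equalityI subsetI)
    fix x assume "x \<in> lattice_of (mat2 1 0 0 (fls_X :: 'a fls))"
    then show "x \<in> residue_kernel 0 \<beta>"
      by (auto simp: lattice_of_def residue_kernel_def std_lattice_iff mat2_vec ints_O_nth_mult)
  next
    fix x assume "x \<in> residue_kernel 0 \<beta>"
    then have O: "x $ 1 \<in> ints_O" "x $ 2 \<in> ints_O" and "fls_nth (x $ 2) 0 = 0"
      using assms by (auto simp: residue_kernel_def std_lattice_iff)
    then obtain z where z: "z \<in> ints_O" "x $ 2 = fls_X * z"
      using ints_O_nth_0_iff[of "x $ 2"] by auto
    have "x = mat2 1 0 0 (fls_X :: 'a fls) *v vector [x $ 1, z]"
      using z(2) by (intro vector_2_eqI) (simp_all add: mat2_vec)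
    moreover have "vector [x $ 1, z] \<in> std_lattice" using z O by (simp add: std_lattice_iff)
    ultimately show "x \<in> lattice_of (mat2 1 0 0 (fls_X :: 'a fls))"
      unfolding lattice_of_def by (rule image_eqI)
  qed
qed

lemma residue_kernel_sublattice:
  assumes "\<alpha> \<noteq> 0 \<or> \<beta> \<noteq> 0"
  shows "scale_set fls_X std_lattice \<subset> residue_kernel \<alpha> \<beta>" (is ?A)
    and "residue_kernel \<alpha> \<beta> \<subset> std_lattice" (is ?B)
    and "quotient_is_residue_field std_lattice (residue_kernel \<alpha> \<beta>)" (is ?C)
proof -
  let ?\<phi> = "\<lambda>x :: 'a fls ^ 2. \<alpha> * fls_nth (x $ 1) 0 + \<beta> * fls_nth (x $ 2) 0"
  \<comment> \<open>A constant vector on which the form vanishes, so that the first inclusion is strict.\<close>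
  let ?k = "vector [fls_const (- \<beta>), fls_const \<alpha>] :: 'a fls ^ 2"
  have "?k \<in> residue_kernel \<alpha> \<beta>" by (auto simp: residue_kernel_def std_lattice_iff)
  moreover have "?k \<notin> scale_set fls_X std_lattice"
  proof
    assume "?k \<in> scale_set fls_X std_lattice"
    then obtain y where y: "y \<in> std_lattice" "?k = fls_X *s y"
      unfolding scale_set_def by (elim imageE)
    have "?k $ 1 = fls_X * y $ 1" "?k $ 2 = fls_X * y $ 2" unfolding y(2) by simp_all
    then have "fls_nth (?k $ 1) 0 = 0" "fls_nth (?k $ 2) 0 = 0"
      using y(1) by (simp_all add: std_lattice_iff ints_O_nth_mult del: vector_2)
    then show False using assms by simp
  qed
  moreover have "scale_set fls_X std_lattice \<subseteq> residue_kernel \<alpha> \<beta>"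
    by (auto simp: scale_set_def residue_kernel_def std_lattice_iff ints_O_nth_mult)
  ultimately show ?A by blast
  have surj: "\<exists>x\<in>std_lattice. ?\<phi> x = y" for y
  proof (cases "\<alpha> = 0")
    case True
    then show ?thesis using assms
      by (intro bexI[of _ "vector [0, fls_const (y / \<beta>)]"]) (auto simp: std_lattice_iff)
  next
    case False
    then show ?thesis
      by (intro bexI[of _ "vector [fls_const (y / \<alpha>), 0]"]) (auto simp: std_lattice_iff)
  qed
  obtain x where "x \<in> std_lattice" "?\<phi> x = 1" using surj by blast
  then have "x \<in> std_lattice" "x \<notin> residue_kernel \<alpha> \<beta>" by (auto simp: residue_kernel_def)
  then show ?B unfolding residue_kernel_def by blast
  show ?C unfolding quotient_is_residue_field_def
  proof (intro exI[of _ ?\<phi>] conjI)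
    show "\<forall>x\<in>std_lattice. \<forall>y\<in>std_lattice. ?\<phi> (x + y) = ?\<phi> x + ?\<phi> y"
      by (simp add: algebra_simps)
    show "\<forall>a\<in>ints_O. \<forall>x\<in>std_lattice. ?\<phi> (a *s x) = fls_nth a 0 * ?\<phi> x"
      by (simp add: std_lattice_iff ints_O_nth_mult algebra_simps)
    show "?\<phi> ` std_lattice = UNIV" using surj by (auto simp: image_iff) metis
    show "{x \<in> std_lattice. ?\<phi> x = 0} = residue_kernel \<alpha> \<beta>"
      by (simp add: residue_kernel_def)
  qed
qed

lemma ball_0_0: "ball_vtx 0 0 = vtx (mat 1)"
  by (simp add: ball_vtx_def ball_mat_def mat_eq_mat2)

lemma lattice_of_mem_vtx: "c \<noteq> 0 \<Longrightarrow> lattice_of (mat c ** g) \<in> vtx g"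
  unfolding vtx_alt by (intro CollectI exI conjI) (rule refl)

text \<open>
  After rescaling, the larger lattice is the standard one. A linear map \<open>\<phi>\<close> from it to the residue
  field only sees the constant coefficients, hence is determined by its values on the two basis
  vectors, and the smaller lattice is the kernel of a nonzero linear form over the residue field.
\<close>

lemma tree_adj_ball_0_0_cases:
  assumes "tree_adj (ball_vtx 0 0) W"
  shows "W = ball_vtx 0 (- 1) \<or> (\<exists>\<gamma>. W = ball_vtx (fls_const \<gamma>) 1)"
proof -
  obtain L L' \<phi> where L: "L \<in> ball_vtx 0 0" "L' \<in> W"
    and add: "\<forall>x\<in>L. \<forall>y\<in>L. \<phi> (x + y) = \<phi> x + \<phi> y"
    and mult: "\<forall>a\<in>ints_O. \<forall>x\<in>L. \<phi> (a *s x) = fls_nth a 0 * \<phi> x"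
    and onto: "\<phi> ` L = UNIV" and ker: "{x \<in> L. \<phi> x = 0} = L'"
    using assms unfolding tree_adj_def quotient_is_residue_field_def by (elim conjE bexE exE)
  have "W \<in> tree_vertices" using assms by (simp add: tree_adj_def)
  then obtain h where h: "W = vtx h" unfolding tree_vertices_eq by (elim CollectE exE conjE)
  obtain e where e: "e \<noteq> 0" "L' = lattice_of (mat e ** h)"
    using L(2) unfolding h vtx_alt by (elim CollectE exE conjE)
  obtain c where c: "c \<noteq> 0" "L = lattice_of (mat c ** mat 1)"
    using L(1) unfolding ball_0_0 vtx_alt by (elim CollectE exE conjE)
  have Lc: "L = (*s) c ` std_lattice"
    unfolding c(2) by (simp add: lattice_of_def mat_vec)
  define \<alpha> where "\<alpha> = \<phi> (c *s vector [1, 0])"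
  define \<beta> where "\<beta> = \<phi> (c *s vector [0, 1])"
  have \<phi>: "\<phi> (c *s x) = \<alpha> * fls_nth (x $ 1) 0 + \<beta> * fls_nth (x $ 2) 0" if "x \<in> std_lattice" for x
  proof -
    have O: "x $ 1 \<in> ints_O" "x $ 2 \<in> ints_O" using that by (auto simp: std_lattice_iff)
    have e12: "c *s vector [1, 0] \<in> L" "c *s vector [0, 1] \<in> L"
      "x $ 1 *s (c *s vector [1, 0]) \<in> L" "x $ 2 *s (c *s vector [0, 1]) \<in> L"
      unfolding Lc using O
         apply (auto simp: std_lattice_iff intro!: imageI)
       apply (intro image_eqI[of _ _ "vector [x $ 1, 0]"] vector_2_eqI; simp add: std_lattice_iff)
      apply (intro image_eqI[of _ _ "vector [0, x $ 2]"] vector_2_eqI; simp add: std_lattice_iff)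
      done
    have "c *s x = x $ 1 *s (c *s vector [1, 0]) + x $ 2 *s (c *s vector [0, 1])"
      by (intro vector_2_eqI) simp_all
    then have "\<phi> (c *s x) = \<phi> (x $ 1 *s (c *s vector [1, 0])) + \<phi> (x $ 2 *s (c *s vector [0, 1]))"
      using add e12 by simp
    also have "\<dots> = fls_nth (x $ 1) 0 * \<alpha> + fls_nth (x $ 2) 0 * \<beta>"
      unfolding \<alpha>_def \<beta>_def using mult O e12(1,2) by metis
    finally show ?thesis by (simp only: mult.commute)
  qed
  have L': "L' = (*s) c ` residue_kernel \<alpha> \<beta>"
    unfolding ker[symmetric] Lc residue_kernel_def using \<phi> by auto
  have nz: "\<alpha> \<noteq> 0 \<or> \<beta> \<noteq> 0"
  proof (rule ccontr)
    assume "\<not> (\<alpha> \<noteq> 0 \<or> \<beta> \<noteq> 0)"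
    then have "\<forall>x\<in>std_lattice. \<phi> (c *s x) = 0" using \<phi> by simp
    then have "\<phi> ` L \<subseteq> {0}" unfolding Lc by auto
    then show False unfolding onto by (metis UNIV_I singletonD subsetD zero_neq_one)
  qed
  have W: "W = vtx g" if "lattice_of g = residue_kernel \<alpha> \<beta>" for g
  proof -
    have "lattice_of (mat e ** h) = (*s) c ` lattice_of g"
      using e(2) L' that by simp
    also have "\<dots> = lattice_of (mat c ** g)"
      unfolding lattice_of_mult[symmetric] mat_vec ..
    finally have "lattice_of (mat e ** h) = lattice_of (mat c ** g)" .
    then have "vtx h = vtx (mat c ** g)" by (rule vtx_eqI[OF e(1)])
    then show ?thesis unfolding h vtx_scale[OF c(1)] .
  qed
  show ?thesis
  proof (cases "\<alpha> = 0")
    case True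
    with nz have "lattice_of (mat fls_X ** ball_mat 0 (- 1)) = residue_kernel \<alpha> \<beta>"
      by (simp add: lattice_of_ball_mat_minus_1)
    from W[OF this] have "W = ball_vtx 0 (- 1)" by (simp add: vtx_scale ball_vtx_def)
    then show ?thesis ..
  next
    case False
    then have "lattice_of (ball_mat (fls_const (- \<beta> / \<alpha>)) 1) = residue_kernel \<alpha> \<beta>"
      by (intro lattice_of_ball_mat_1) auto
    from W[OF this] have "W = ball_vtx (fls_const (- \<beta> / \<alpha>)) 1" by (simp only: ball_vtx_def)
    then show ?thesis by (intro disjI2 exI)
  qed
qed

lemma tree_adj_ball_0_0:
  "tree_adj (ball_vtx 0 0) W \<longleftrightarrow> W = ball_vtx 0 (- 1) \<or> (\<exists>\<gamma>. W = ball_vtx (fls_const \<gamma>) 1)"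
proof
  have std: "std_lattice \<in> ball_vtx 0 0"
    using lattice_of_mem_vtx[of 1 "mat 1"] by (simp add: ball_0_0)
  have adj: "tree_adj (ball_vtx 0 0) (ball_vtx b n)"
    if "residue_kernel \<alpha> \<beta> \<in> ball_vtx b n" "\<alpha> \<noteq> 0 \<or> \<beta> \<noteq> 0" for b n and \<alpha> \<beta> :: 'a
    unfolding tree_adj_def using residue_kernel_sublattice[OF that(2)] that(1) std
    by (intro conjI bexI) simp_all
  assume "W = ball_vtx 0 (- 1) \<or> (\<exists>\<gamma>. W = ball_vtx (fls_const \<gamma>) 1)"
  then show "tree_adj (ball_vtx 0 0) W"
  proof (elim disjE exE)
    assume W: "W = ball_vtx 0 (- 1)"
    have "residue_kernel 0 (1::'a) = lattice_of (mat fls_X ** ball_mat 0 (- 1))"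
      by (rule lattice_of_ball_mat_minus_1[symmetric]) simp
    also have "\<dots> \<in> ball_vtx 0 (- 1)"
      unfolding ball_vtx_def by (rule lattice_of_mem_vtx) simp
    finally have "residue_kernel 0 1 \<in> (ball_vtx 0 (- 1) :: 'a vert)" .
    then show ?thesis unfolding W by (rule adj) simp
  next
    fix \<gamma> assume W: "W = ball_vtx (fls_const \<gamma>) 1"
    have "residue_kernel 1 (- \<gamma>) \<in> ball_vtx (fls_const \<gamma>) 1"
      using lattice_of_mem_vtx[of 1 "ball_mat (fls_const \<gamma>) 1"]
      by (simp add: lattice_of_ball_mat_1[of 1 \<gamma> "- \<gamma>"] ball_vtx_def)
    then show ?thesis unfolding W by (rule adj) simp
  qed
qed (rule tree_adj_ball_0_0_cases)

lemma act_ball: "act (ball_mat b n) (ball_vtx c m) = ball_vtx (b + c * pow_pi n) (n + m)"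
  by (simp add: ball_vtx_def act_vtx ball_mat_mult)

lemma ball_mat_inverse: "ball_mat (- b / pow_pi n) (- n) ** ball_mat b n = mat 1"
  "ball_mat b n ** ball_mat (- b / pow_pi n) (- n) = mat 1"
  using pow_pi_add[of n "- n"]
  by (auto simp add: ball_mat_def mat2_mult mat_eq_mat2 field_simps)

text \<open>
  All vertices have the same neighbourhood structure, by transport from the ball \<open>O\<close>: the neighbours of
  a ball are the next larger ball around it and the \<open>q\<close> next smaller balls inside it.
\<close>

lemma tree_adj_ball:
  "tree_adj (ball_vtx b n) W \<longleftrightarrow>
    W = ball_vtx b (n - 1) \<or> (\<exists>\<gamma>. W = ball_vtx (b + fls_const \<gamma> * pow_pi n) (n + 1))"
proof -
  let ?M = "ball_mat b n" and ?N = "ball_mat (- b / pow_pi n) (- n)"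
  have M0: "act ?M (ball_vtx 0 0) = ball_vtx b n" by (simp add: act_ball)
  show ?thesis
  proof
    assume adj: "tree_adj (ball_vtx b n) W"
    then have "W \<in> tree_vertices" by (simp add: tree_adj_def)
    then have W: "W = act ?M (act ?N W)"
      by (rule act_act_inverse[OF _ ball_mat_inverse(2), symmetric])
    have "tree_adj (act ?N (act ?M (ball_vtx 0 0))) (act ?N W)"
      unfolding M0 by (rule tree_adj_act[OF invertible_ball_mat adj])
    then have "tree_adj (ball_vtx 0 0) (act ?N W)"
      by (simp only: act_act_inverse[OF ball_in_tree ball_mat_inverse(1)])
    then consider "act ?N W = ball_vtx 0 (- 1)" | \<gamma> where "act ?N W = ball_vtx (fls_const \<gamma>) 1"
      unfolding tree_adj_ball_0_0 by (elim disjE exE)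
    then show "W = ball_vtx b (n - 1) \<or> (\<exists>\<gamma>. W = ball_vtx (b + fls_const \<gamma> * pow_pi n) (n + 1))"
    proof cases
      case 1
      then have "W = ball_vtx b (n - 1)" by (subst W) (simp add: act_ball)
      then show ?thesis ..
    next
      case 2
      then have "W = ball_vtx (b + fls_const \<gamma> * pow_pi n) (n + 1)" by (subst W) (simp add: act_ball)
      then show ?thesis by (intro disjI2 exI)
    qed
  next
    assume "W = ball_vtx b (n - 1) \<or> (\<exists>\<gamma>. W = ball_vtx (b + fls_const \<gamma> * pow_pi n) (n + 1))"
    then obtain W0 where W0: "tree_adj (ball_vtx 0 0) W0" "W = act ?M W0"
    proof (elim disjE exE)
      assume "W = ball_vtx b (n - 1)"
      then show ?thesis by (intro that[of "ball_vtx 0 (- 1)"]) (simp_all add: tree_adj_ball_0_0 act_ball)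
    next
      fix \<gamma> assume "W = ball_vtx (b + fls_const \<gamma> * pow_pi n) (n + 1)"
      then show ?thesis
        by (intro that[of "ball_vtx (fls_const \<gamma>) 1"])
          (simp_all add: tree_adj_ball_0_0 act_ball, intro disjI2 exI, rule refl)
    qed
    from tree_adj_act[OF invertible_ball_mat W0(1)] show "tree_adj (ball_vtx b n) W"
      unfolding W0(2) M0[symmetric] .
  qed
qed

lemma ball_parent_cong:
  assumes "ball_vtx b n = ball_vtx b' n'" shows "ball_vtx b (n - 1) = ball_vtx b' (n' - 1)"
proof -
  have n: "n = n'" and *: "(b - b') / pow_pi n \<in> ints_O" using assms unfolding ball_eq_iff by blast+
  have "(b - b') / pow_pi (n - 1) = fls_X * ((b - b') / pow_pi n)"
    by (simp only: pow_pi_diff pow_pi_simps) (simp only: divide_divide_eq_right times_divide_eq_right mult.commute)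
  also have "\<dots> \<in> ints_O" using * by (intro ints_O_closed)
  finally show ?thesis using n by (simp add: ball_eq_iff)
qed

text \<open>
  For a ball \<open>b + \<pi>\<^sup>n O\<close> the level is \<open>n\<close> and the parent is the next larger ball. Each edge joins
  a vertex to its parent; this is what excludes cycles later.
\<close>

definition level :: "'a::{field,finite} vert \<Rightarrow> int" where
  "level V = (THE n. \<exists>b. V = ball_vtx b n)"

definition parent :: "'a::{field,finite} vert \<Rightarrow> 'a vert" where
  "parent V = (THE W. \<exists>b n. V = ball_vtx b n \<and> W = ball_vtx b (n - 1))"

lemma level_ball [simp]: "level (ball_vtx b n) = n"
  unfolding level_def
proof (rule the_equality)
  show "\<exists>c. ball_vtx b n = ball_vtx c n" by (intro exI, rule refl)
qed (auto simp: ball_eq_iff)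

lemma parent_ball [simp]: "parent (ball_vtx b n) = ball_vtx b (n - 1)"
  unfolding parent_def
proof (rule the_equality)
  fix W assume "\<exists>b' n'. ball_vtx b n = ball_vtx b' n' \<and> W = ball_vtx b' (n' - 1)"
  then show "W = ball_vtx b (n - 1)" using ball_parent_cong by metis
qed (intro exI conjI; rule refl)

lemma pow_pi_Suc_divide: "a * pow_pi n / pow_pi (n + 1) = a / fls_X"
  by (simp add: pow_pi_add del: fls_divide_X)

lemma ball_child_parent: "ball_vtx (b + fls_const \<gamma> * pow_pi n) n = ball_vtx b n"
  by (simp add: ball_eq_iff)

lemma tree_adj_levels:
  assumes "tree_adj V W"
  shows "W = parent V \<and> level W = level V - 1 \<or> V = parent W \<and> level W = level V + 1"
proof -
  have "V \<in> tree_vertices" using assms by (simp add: tree_adj_def)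
  then obtain b n where V: "V = ball_vtx b n" by (rule vertex_is_ball)
  consider "W = ball_vtx b (n - 1)" | \<gamma> where "W = ball_vtx (b + fls_const \<gamma> * pow_pi n) (n + 1)"
    using assms unfolding V tree_adj_ball by (elim disjE exE)
  then show ?thesis unfolding V by cases (simp_all add: ball_child_parent)
qed

lemma tree_adj_sym: "tree_adj V W \<longleftrightarrow> tree_adj W V"
proof -
  have "tree_adj W V" if adj: "tree_adj V W" for V W :: "'a vert"
  proof -
    have "V \<in> tree_vertices" using adj by (simp add: tree_adj_def)
    then obtain b n where V: "V = ball_vtx b n" by (rule vertex_is_ball)
    consider "W = ball_vtx b (n - 1)" | \<gamma> where "W = ball_vtx (b + fls_const \<gamma> * pow_pi n) (n + 1)"
      using adj unfolding V tree_adj_ball by (elim disjE exE)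
    then show ?thesis
    proof cases
      case 1
      have "ball_vtx b n = ball_vtx (b + fls_const 0 * pow_pi (n - 1)) (n - 1 + 1)" by simp
      then show ?thesis unfolding 1 V tree_adj_ball by (intro disjI2 exI)
    next
      case 2
      show ?thesis unfolding 2 V tree_adj_ball by (simp add: ball_child_parent)
    qed
  qed
  then show ?thesis by (intro iffI)
qed

definition nbrs :: "'a::{field,finite} vert \<Rightarrow> 'a vert set" where
  "nbrs V = {W. tree_adj V W}"

lemma nbrs_ball:
  "nbrs (ball_vtx b n) = insert (ball_vtx b (n - 1))
    (range (\<lambda>\<gamma>. ball_vtx (b + fls_const \<gamma> * pow_pi n) (n + 1)))"
  unfolding nbrs_def tree_adj_ball by (auto simp only: image_iff mem_Collect_eq insert_iff UNIV_I)

lemma inj_ball_children: "inj (\<lambda>\<gamma>. ball_vtx (b + fls_const \<gamma> * pow_pi n) (n + 1))"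
proof (rule injI)
  fix \<gamma> \<delta>
  assume "ball_vtx (b + fls_const \<gamma> * pow_pi n) (n + 1) = ball_vtx (b + fls_const \<delta> * pow_pi n) (n + 1)"
  then have "fls_const (\<gamma> - \<delta>) * pow_pi n / pow_pi (n + 1) \<in> ints_O"
    by (simp add: ball_eq_iff algebra_simps flip: fls_minus_const)
  then have "fls_const (\<gamma> - \<delta>) = 0 \<or> 1 \<le> fls_subdegree (fls_const (\<gamma> - \<delta>))"
    using pow_pi_dvd_iff[of "fls_const (\<gamma> - \<delta>)" 1] by (simp add: pow_pi_Suc_divide)
  then show "\<gamma> = \<delta>" by simp
qed

lemma ball_parent_not_child:
  "ball_vtx b (n - 1) \<notin> range (\<lambda>\<gamma>. ball_vtx (b + fls_const \<gamma> * pow_pi n) (n + 1))"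
proof
  assume "ball_vtx b (n - 1) \<in> range (\<lambda>\<gamma>. ball_vtx (b + fls_const \<gamma> * pow_pi n) (n + 1))"
  then obtain \<gamma> where "ball_vtx b (n - 1) = ball_vtx (b + fls_const \<gamma> * pow_pi n) (n + 1)"
    by (elim imageE)
  then show False by (simp add: ball_eq_iff)
qed

section \<open>Polynomials in the Laurent series field\<close>

definition eval_t :: "'a::{field,finite} poly \<Rightarrow> 'a fls" where
  "eval_t p = poly (map_poly fls_const p) fls_X_inv"

lemma polys_t_eq: "polys_t = range eval_t"
  by (simp add: polys_t_def eval_t_def)

lemma eval_t_pCons [simp]: "eval_t (pCons a p) = fls_const a + fls_X_inv * eval_t p"
  by (simp add: eval_t_def map_poly_pCons)

lemma eval_t_0 [simp]: "eval_t 0 = 0"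
  by (simp add: eval_t_def)

lemma eval_t_add: "eval_t (p + q) = eval_t p + eval_t q"
proof -
  have "map_poly fls_const (p + q) = map_poly fls_const p + map_poly fls_const q"
    by (rule poly_eqI) (simp add: coeff_map_poly fls_plus_const)
  then show ?thesis by (simp add: eval_t_def)
qed

lemma eval_t_smult: "eval_t (smult a p) = fls_const a * eval_t p"
  by (induction p) (simp_all add: algebra_simps)

lemma eval_t_mult: "eval_t (p * q) = eval_t p * eval_t q"
  by (induction p) (simp_all add: eval_t_add eval_t_smult algebra_simps)

lemma polys_t_closed [simp, intro]:
  fixes a :: "'a::{field,finite}" and x y :: "'a fls"
  shows "0 \<in> (polys_t :: 'a fls set)" "1 \<in> (polys_t :: 'a fls set)"
  "fls_const a \<in> polys_t" "fls_X_inv ^ n \<in> (polys_t :: 'a fls set)"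
  "x \<in> polys_t \<Longrightarrow> y \<in> polys_t \<Longrightarrow> x + y \<in> polys_t"
  "x \<in> polys_t \<Longrightarrow> y \<in> polys_t \<Longrightarrow> x * y \<in> polys_t"
  "x \<in> polys_t \<Longrightarrow> - x \<in> polys_t"
proof -
  have C: "fls_const a \<in> polys_t" for a :: 'a
    unfolding polys_t_eq by (rule range_eqI[of _ _ "[:a:]"]) simp
  have T: "fls_X_inv \<in> (polys_t :: 'a fls set)"
    unfolding polys_t_eq by (rule range_eqI[of _ _ "[:0, 1:]"]) simp
  have M: "x * y \<in> polys_t" if "x \<in> polys_t" "y \<in> polys_t" for x y :: "'a fls"
    using that unfolding polys_t_eq by (auto simp flip: eval_t_mult)
  show "0 \<in> (polys_t :: 'a fls set)" "1 \<in> (polys_t :: 'a fls set)" "fls_const a \<in> polys_t"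
    using C[of 0] C[of 1] C by simp_all
  then show "fls_X_inv ^ n \<in> (polys_t :: 'a fls set)" using T M by (induction n) simp_all
  show "x \<in> polys_t \<Longrightarrow> y \<in> polys_t \<Longrightarrow> x + y \<in> polys_t"
    unfolding polys_t_eq by (auto simp flip: eval_t_add)
  show "x \<in> polys_t \<Longrightarrow> y \<in> polys_t \<Longrightarrow> x * y \<in> polys_t" by (rule M)
  show "x \<in> polys_t \<Longrightarrow> - x \<in> polys_t"
    using M[OF C[of "- 1"], of x] by simp
qed

lemma eval_t_nth_pos: "n > 0 \<Longrightarrow> fls_nth (eval_t p) n = 0"
  by (induction p arbitrary: n) (auto simp: fls_X_inv_times_conv_shift)

text \<open>
  The valuation of a polynomial in \<open>t\<close> is minus its degree.
\<close>

lemma polys_t_subdegree: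
  assumes "x \<in> polys_t" shows "fls_subdegree x \<le> 0"
proof (rule ccontr)
  assume *: "\<not> fls_subdegree x \<le> 0"
  then have "fls_nth x (fls_subdegree x) = 0"
    using assms eval_t_nth_pos[of "fls_subdegree x"] by (auto simp: polys_t_eq)
  then have "x = 0" using nth_fls_subdegree_nonzero by metis
  then show False using * by simp
qed

section \<open>The action of the polynomial group and the heights of neighbours\<close>

lemma mat2_in_GL2_polys:
  assumes "a \<in> polys_t" "b \<in> polys_t" "c \<in> polys_t" "d \<in> polys_t"
    and "a * d - b * c = 1 \<or> a * d - b * c = - 1"
  shows "mat2 a b c d \<in> GL2_polys"
proof -
  let ?D = "a * d - b * c"
  have D: "?D \<noteq> 0" using assms(5) by auto
  have *: "x / ?D \<in> polys_t" if "x \<in> polys_t" for x using assms(5) that by (elim disjE) auto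
  show ?thesis unfolding GL2_polys_def
    using assms * mat2_inverse[OF D]
    by (intro CollectI conjI exI[of _ "mat2 (d / ?D) (- b / ?D) (- c / ?D) (a / ?D)"])
      (auto simp only: forall_2 mat2_nth polys_t_closed)
qed

lemma GL2_polys_mult:
  fixes g h :: "'a::{field,finite} fls ^ 2 ^ 2"
  assumes "g \<in> GL2_polys" "h \<in> GL2_polys"
  shows "g ** h \<in> GL2_polys"
proof -
  obtain g' h' :: "'a fls ^ 2 ^ 2" where inv: "g ** g' = mat 1" "g' ** g = mat 1" "h ** h' = mat 1" "h' ** h = mat 1"
    and P: "\<forall>i j. g' $ i $ j \<in> polys_t" "\<forall>i j. h' $ i $ j \<in> polys_t"
      "\<forall>i j. g $ i $ j \<in> polys_t" "\<forall>i j. h $ i $ j \<in> polys_t"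
    using assms unfolding GL2_polys_def by blast
  have "(g ** h) ** (h' ** g') = mat 1" "(h' ** g') ** (g ** h) = mat 1"
    using inv by (metis matrix_mul_assoc matrix_mul_lid)+
  moreover have "\<forall>i j. (g ** h) $ i $ j \<in> polys_t" "\<forall>i j. (h' ** g') $ i $ j \<in> polys_t"
    using P by (simp_all add: matrix_matrix_mult_def sum_2)
  ultimately show ?thesis unfolding GL2_polys_def by blast
qed

lemma GL2_polys_inverse:
  assumes "g \<in> GL2_polys"
  obtains h where "h \<in> GL2_polys" "g ** h = mat 1" "h ** g = mat 1"
  using assms unfolding GL2_polys_def by blast

lemma GL2_polys_invertible: "g \<in> GL2_polys \<Longrightarrow> invertible g"
  unfolding GL2_polys_def invertible_def by blast

lemma GL2_polys_1: "mat 1 \<in> GL2_polys"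
  unfolding mat_eq_mat2 by (rule mat2_in_GL2_polys) auto

lemma GL2_polys_det:
  assumes "mat2 a b c d \<in> GL2_polys"
  shows "a \<in> polys_t" "b \<in> polys_t" "c \<in> polys_t" "d \<in> polys_t"
    "a * d - b * c \<noteq> 0" "fls_subdegree (a * d - b * c) = 0"
proof -
  obtain h where h: "h \<in> GL2_polys" "mat2 a b c d ** h = mat 1" "h ** mat2 a b c d = mat 1"
    using assms by (rule GL2_polys_inverse)
  obtain a' b' c' d' where abcd: "h = mat2 a' b' c' d'" by (rule mat2_cases)
  show P: "a \<in> polys_t" "b \<in> polys_t" "c \<in> polys_t" "d \<in> polys_t"
    using assms by (simp_all add: GL2_polys_def forall_2)
  have P': "a' \<in> polys_t" "b' \<in> polys_t" "c' \<in> polys_t" "d' \<in> polys_t"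
    using h(1) unfolding abcd by (simp_all add: GL2_polys_def forall_2)
  have "det (mat2 a b c d) * det h = 1" using h(2) by (simp flip: det_mul)
  then have D: "(a * d - b * c) * (a' * d' - b' * c') = 1" by (simp only: abcd det_mat2)
  then show nz: "a * d - b * c \<noteq> 0" by auto
  have nz': "a' * d' - b' * c' \<noteq> 0" using D by auto
  have "fls_subdegree (a * d - b * c) + fls_subdegree (a' * d' - b' * c') = 0"
    using fls_subdegree_mult[OF nz nz'] D by simp
  moreover have "a * d + - (b * c) \<in> polys_t" "a' * d' + - (b' * c') \<in> polys_t"
    using P P' by blast+
  ultimately show "fls_subdegree (a * d - b * c) = 0"
    using polys_t_subdegree[of "a * d + - (b * c)"] polys_t_subdegree[of "a' * d' + - (b' * c')"]
    by simp
qed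

lemma ray_vertex_eq: "(ray_vertex n :: 'a::{field,finite} vert) = ball_vtx 0 (- int n)"
proof -
  have "homothety_class std_lattice = (vtx (mat 1) :: 'a vert)" by (simp add: vtx_def)
  then show ?thesis
    by (simp add: ray_vertex_def act_vtx ball_vtx_def ball_mat_def diag_t_def mat2_def)
qed

text \<open>
  If \<open>g\<close> maps the lattice of \<open>v\<^sub>n\<close> to \<open>e\<close> times that of \<open>v\<^sub>m\<close>, the determinant gives
  \<open>2 v(e) = m - n\<close>, and integrality bounds \<open>v(e)\<close> from above by the valuations of the entries of
  \<open>g\<close>, which are at most \<open>0\<close>. A nonzero lower left entry gives \<open>v(e) \<le> - n\<close>, whence
  \<open>m + n \<le> 0\<close>. Otherwise the diagonal entries are constants, and they give \<open>v(e) \<le> 0\<close> and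
  \<open>v(e) \<le> m - n\<close>, whence \<open>v(e) = 0\<close>.
\<close>

lemma ray_vertices_inequivalent:
  assumes g: "g \<in> GL2_polys" and eq: "act g (ray_vertex n) = ray_vertex m"
  shows "n = m"
proof -
  obtain a b c d where abcd: "g = mat2 a b c d" by (rule mat2_cases)
  note G = GL2_polys_det[OF g[unfolded abcd]]
  have "vtx (g ** ball_mat 0 (- int n)) = vtx (ball_mat 0 (- int m))"
    using eq unfolding ray_vertex_eq ball_vtx_def act_vtx .
  then obtain e k l p r where e: "e \<noteq> 0"
    and M: "g ** ball_mat 0 (- int n) = mat e ** (ball_mat 0 (- int m) ** mat2 k l p r)"
    and O: "k \<in> ints_O" "l \<in> ints_O" "p \<in> ints_O" "r \<in> ints_O"
    and D: "k * r - l * p \<noteq> 0" "fls_subdegree (k * r - l * p) = 0"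
    by (rule vtx_eqE[OF invertible_mult[OF GL2_polys_invertible[OF g] invertible_ball_mat] invertible_ball_mat])
  let ?s = "fls_subdegree e"
  have E: "a * pow_pi (- int n) = e * (pow_pi (- int m) * k)"
    "c * pow_pi (- int n) = e * p" "d = e * r"
    using M by (simp_all add: abcd ball_mat_def mat2_mult mat_eq_mat2 del: pow_pi_uminus)
  have "det (g ** ball_mat 0 (- int n)) = det (mat e ** (ball_mat 0 (- int m) ** mat2 k l p r))"
    using M by simp
  then have "(a * d - b * c) * pow_pi (- int n) = e * e * (pow_pi (- int m) * (k * r - l * p))"
    by (simp add: det_mul abcd ball_mat_def det_mat2 mat_eq_mat2 del: pow_pi_uminus)
  then have "fls_subdegree ((a * d - b * c) * pow_pi (- int n)) =
      fls_subdegree (e * e * (pow_pi (- int m) * (k * r - l * p)))" by (rule arg_cong)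
  then have s: "- int n = 2 * ?s - int m"
    using G(5,6) D e by (simp del: pow_pi_uminus)
  have sub: "fls_subdegree x \<le> fls_subdegree (x * y)" if "y \<in> ints_O" "x * y \<noteq> 0" for x y :: "'a fls"
    using that by (cases "x = 0"; cases "y = 0") (auto simp: ints_O_iff)
  show ?thesis
  proof (cases "c = 0")
    case False
    have "?s \<le> fls_subdegree (c * pow_pi (- int n))"
      using sub[OF O(3), of e] False E(2) by (metis mult_eq_0_iff pow_pi_simps(1))
    then have "?s \<le> fls_subdegree c - int n" using False by (simp del: pow_pi_uminus)
    then show ?thesis using polys_t_subdegree[OF G(3)] s by simp
  next
    case True
    with G have ad: "a \<noteq> 0" "d \<noteq> 0" "fls_subdegree a + fls_subdegree d = 0" by auto
    then have 0: "fls_subdegree a = 0" "fls_subdegree d = 0"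
      using polys_t_subdegree[OF G(1)] polys_t_subdegree[OF G(4)] by simp_all
    have "?s \<le> 0" using sub[OF O(4), of e] ad(2) 0(2) E(3) by simp
    moreover have "?s - int m \<le> - int n"
    proof -
      have "fls_subdegree (e * pow_pi (- int m)) \<le> fls_subdegree (e * pow_pi (- int m) * k)"
        using sub[OF O(1), of "e * pow_pi (- int m)"] E(1) ad(1) by (metis mult.assoc mult_eq_0_iff pow_pi_simps(1))
      also have "e * pow_pi (- int m) * k = a * pow_pi (- int n)" using E(1) by (simp only: mult.assoc)
      finally show ?thesis using e ad(1) 0(1) by (simp del: pow_pi_uminus)
    qed
    ultimately show ?thesis using s by simp
  qed
qed

lemma ray_vertex_in_tree [simp]: "ray_vertex n \<in> tree_vertices"
  by (simp add: ray_vertex_eq)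

lemma act_mult: "V \<in> tree_vertices \<Longrightarrow> act g (act h V) = act (g ** h) V"
  unfolding tree_vertices_eq by (elim CollectE exE conjE) (simp only: act_vtx matrix_mul_assoc)

lemma height_act_ray:
  assumes g: "g \<in> GL2_polys" shows "height (act g (ray_vertex n)) = n"
  unfolding height_def
proof (rule the_equality)
  show "\<exists>h\<in>GL2_polys. act g (ray_vertex n) = act h (ray_vertex n)" by (rule bexI[OF refl g])
next
  fix m assume "\<exists>h\<in>GL2_polys. act g (ray_vertex n) = act h (ray_vertex m)"
  then obtain h where h: "h \<in> GL2_polys" "act g (ray_vertex n) = act h (ray_vertex m)" by (elim bexE)
  obtain h' where h': "h' \<in> GL2_polys" "h' ** h = mat 1" using GL2_polys_inverse[OF h(1)] by metis
  have "act (h' ** g) (ray_vertex n) = act h' (act h (ray_vertex m))"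
    by (simp only: act_mult[symmetric] h(2)[symmetric] ray_vertex_in_tree)
  also have "\<dots> = ray_vertex m" by (rule act_act_inverse[OF ray_vertex_in_tree h'(2)])
  finally have "n = m" by (rule ray_vertices_inequivalent[OF GL2_polys_mult[OF h'(1) g]])
  then show "m = n" ..
qed

lemma act_1: "V \<in> tree_vertices \<Longrightarrow> act (mat 1) V = V"
  using act_act_inverse[of V "mat 1" "mat 1"] act_mult[of V "mat 1" "mat 1"] by simp

lemma height_ray [simp]: "height (ray_vertex n) = n"
  using height_act_ray[OF GL2_polys_1, of n] by (simp add: act_1)

text \<open>
  The children of the ball \<open>t\<^sup>n O\<close> are the balls \<open>\<gamma> t\<^sup>n + t\<^bsup>n-1\<^esup> O\<close>. A translation by
  the polynomial \<open>\<gamma> t\<^sup>n\<close> moves each to the centre \<open>0\<close>. This is a vertex of the ray when \<open>n \<ge> 1\<close>;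
  for \<open>n = 0\<close> it is \<open>\<pi> O\<close>, which the exchange of the two coordinates maps to \<open>t O\<close>.
\<close>

lemma ray_child_orbit:
  fixes \<gamma> :: "'a::{field,finite}"
  shows "\<exists>g\<in>GL2_polys. ball_vtx (fls_const \<gamma> * pow_pi (- int n)) (- int n + 1) =
     act g (ray_vertex (if n = 0 then 1 else n - 1))"
proof -
  let ?p = "fls_const \<gamma> * pow_pi (- int n)"
  have T: "ball_mat ?p 0 \<in> GL2_polys"
    unfolding ball_mat_def by (rule mat2_in_GL2_polys) auto
  have child: "ball_vtx ?p (- int n + 1) = act (ball_mat ?p 0) (ball_vtx 0 (- int n + 1))"
    by (simp only: act_ball) simp
  show ?thesis
  proof (cases "n = 0")
    case False
    then have "ball_vtx 0 (- int n + 1) = (ray_vertex (n - 1) :: 'a vert)" by (simp add: ray_vertex_eq of_nat_diff)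
    then show ?thesis using T child False by (intro bexI[of _ "ball_mat ?p 0"]) simp_all
  next
    case True
    let ?w = "mat2 0 1 1 (0 :: 'a fls)"
    have w: "?w \<in> GL2_polys" by (rule mat2_in_GL2_polys) auto
    have "?w ** ball_mat 0 (- 1) = mat fls_X_inv ** (ball_mat 0 1 ** ?w)"
      by (simp add: ball_mat_def mat_eq_mat2 mat2_mult flip: fls_inverse_X)
    then have "act ?w (ray_vertex 1) = vtx (mat fls_X_inv ** (ball_mat 0 1 ** ?w))"
      unfolding ray_vertex_eq ball_vtx_def act_vtx by simp
    also have "\<dots> = vtx (ball_mat 0 1 ** ?w)" by (rule vtx_scale) simp
    also have "\<dots> = ball_vtx 0 1" unfolding ball_vtx_def by (rule vtx_mult_unimodular) auto
    finally have "ball_vtx ?p (- int n + 1) = act (ball_mat ?p 0) (act ?w (ray_vertex 1))"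
      using True child by simp
    also have "\<dots> = act (ball_mat ?p 0 ** ?w) (ray_vertex 1)" by (rule act_mult) simp
    finally show ?thesis using GL2_polys_mult[OF T w] True by (intro bexI[of _ "ball_mat ?p 0 ** ?w"]) simp_all
  qed
qed

lemma nbrs_ray:
  "nbrs (ray_vertex n) = insert (ray_vertex (n + 1))
    (range (\<lambda>\<gamma>. ball_vtx (fls_const \<gamma> * pow_pi (- int n)) (- int n + 1)))"
proof -
  have n: "- int (n + 1) = - int n - 1" by simp
  show ?thesis unfolding ray_vertex_eq nbrs_ball n by (simp del: pow_pi_uminus)
qed

lemma nbrs_act:
  assumes "V \<in> tree_vertices" and g: "g \<in> GL2_polys"
  shows "nbrs (act g V) = act g ` nbrs V"
proof -
  obtain h where h: "h \<in> GL2_polys" "g ** h = mat 1" "h ** g = mat 1"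
    using g by (rule GL2_polys_inverse)
  show ?thesis
  proof (intro equalityI subsetI)
    fix W assume "W \<in> nbrs (act g V)"
    then have adj: "tree_adj (act g V) W" by (simp add: nbrs_def)
    then have "W \<in> tree_vertices" by (simp add: tree_adj_def)
    then have W: "W = act g (act h W)" by (rule act_act_inverse[OF _ h(2), symmetric])
    have "tree_adj (act h (act g V)) (act h W)"
      by (rule tree_adj_act[OF GL2_polys_invertible[OF h(1)] adj])
    then have "act h W \<in> nbrs V" unfolding act_act_inverse[OF assms(1) h(3)] by (simp add: nbrs_def)
    then show "W \<in> act g ` nbrs V" using W by (rule rev_image_eqI)
  next
    fix W assume "W \<in> act g ` nbrs V"
    then show "W \<in> nbrs (act g V)"
      using tree_adj_act[OF GL2_polys_invertible[OF g]] by (elim imageE) (simp add: nbrs_def)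
  qed
qed

lemma orbit_step:
  assumes "g \<in> GL2_polys" "W \<in> nbrs (act g (ray_vertex n))"
  shows "\<exists>m. \<exists>h\<in>GL2_polys. W = act h (ray_vertex m)"
proof -
  obtain U where U: "U \<in> nbrs (ray_vertex n)" "W = act g U"
    using assms(2) unfolding nbrs_act[OF ray_vertex_in_tree assms(1)] by (elim imageE)
  have "\<exists>m. \<exists>h\<in>GL2_polys. U = act h (ray_vertex m)"
    using U(1) unfolding nbrs_ray
  proof (elim insertE imageE)
    assume "U = ray_vertex (n + 1)"
    then have "U = act (mat 1) (ray_vertex (n + 1))" by (simp add: act_1)
    then show ?thesis using GL2_polys_1 by (intro exI bexI)
  next
    fix \<gamma> assume U: "U = ball_vtx (fls_const \<gamma> * pow_pi (- int n)) (- int n + 1)"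
    show ?thesis unfolding U using ray_child_orbit by (intro exI)
  qed
  then obtain m h where h: "h \<in> GL2_polys" "U = act h (ray_vertex m)" by (elim exE bexE)
  have "W = act (g ** h) (ray_vertex m)" unfolding U(2) h(2) by (rule act_mult) simp
  then show ?thesis using GL2_polys_mult[OF assms(1) h(1)] by (intro exI bexI)
qed

text \<open>
  The orbits of the ray vertices are closed under passing to a neighbour. A ball around \<open>b\<close> that is large
  enough contains \<open>0\<close> and is itself on the ray, and every smaller ball around \<open>b\<close> is reached from it
  along children.
\<close>

lemma vertex_in_orbit:
  assumes "V \<in> tree_vertices"
  shows "\<exists>g\<in>GL2_polys. V = act g (ray_vertex (height V))"
proof -
  obtain b n where V: "V = ball_vtx b n" using assms by (rule vertex_is_ball)
  define m where "m = min n (min 0 (fls_subdegree b))"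
  have m: "m \<le> 0" by (simp add: m_def)
  have "\<exists>k. \<exists>g\<in>GL2_polys. ball_vtx b i = act g (ray_vertex k)" if "m \<le> i" for i
    using that
  proof (induction i rule: int_ge_induct)
    case base
    have "ball_vtx b m = ball_vtx 0 m" by (simp add: ball_eq_iff pow_pi_dvd_iff m_def min.coboundedI2)
    also have "\<dots> = ray_vertex (nat (- m))" using m by (simp add: ray_vertex_eq)
    also have "\<dots> = act (mat 1) (ray_vertex (nat (- m)))" by (simp add: act_1)
    finally show ?case using GL2_polys_1 by (intro exI bexI)
  next
    case (step i)
    then obtain k g where g: "g \<in> GL2_polys" "ball_vtx b i = act g (ray_vertex k)" by (elim exE bexE)
    have "ball_vtx b (i + 1) = ball_vtx (b + fls_const 0 * pow_pi i) (i + 1)" by simp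
    then have "ball_vtx b (i + 1) \<in> nbrs (ball_vtx b i)"
      unfolding nbrs_ball by (intro insertI2 range_eqI)
    then show ?case using orbit_step[OF g(1)] unfolding g(2) by blast
  qed
  then have "\<exists>k. \<exists>g\<in>GL2_polys. V = act g (ray_vertex k)" unfolding V m_def by simp
  then obtain k g where g: "g \<in> GL2_polys" "V = act g (ray_vertex k)" by (elim exE bexE)
  then have "height V = k" by (simp add: height_act_ray)
  then show ?thesis using g by (intro bexI) simp_all
qed

lemma height_act:
  assumes "V \<in> tree_vertices" "g \<in> GL2_polys" shows "height (act g V) = height V"
proof -
  obtain h where h: "h \<in> GL2_polys" "V = act h (ray_vertex (height V))"
    using vertex_in_orbit[OF assms(1)] by (elim bexE)
  have "height (act g (act h (ray_vertex (height V)))) = height V"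
    unfolding act_mult[OF ray_vertex_in_tree] by (rule height_act_ray[OF GL2_polys_mult[OF assms(2) h(1)]])
  then show ?thesis using h(2) by simp
qed

text \<open>
  At the ray vertex \<open>v\<^sub>n\<close> the distinguished neighbour \<open>u\<close> is the parent \<open>v\<^bsub>n+1\<^esub>\<close> and \<open>A\<close>
  consists of the children; a general vertex is a translate. For height \<open>0\<close> all neighbours have height
  \<open>1\<close>, and the choice of \<open>u\<close> among them is immaterial.
\<close>

lemma nbrs_heights:
  fixes V :: "'a::{field,finite} vert"
  assumes "V \<in> tree_vertices"
  obtains u A where "nbrs V = insert u A" "u \<notin> A" "finite A" "card A = CARD('a)"
    "height u = height V + 1" "\<forall>w\<in>A. height w = (if height V = 0 then 1 else height V - 1)"
proof -
  define n where "n = height V"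
  obtain g where g: "g \<in> GL2_polys" "V = act g (ray_vertex n)"
    using vertex_in_orbit[OF assms] unfolding n_def by (elim bexE)
  obtain h where h: "h ** g = mat 1" using GL2_polys_inverse[OF g(1)] by metis
  define c where "c = (\<lambda>\<gamma> :: 'a. ball_vtx (fls_const \<gamma> * pow_pi (- int n)) (- int n + 1))"
  define A where "A = act g ` range c"
  have inj: "inj_on (act g) tree_vertices"
    by (rule inj_on_inverseI[where g = "act h"]) (rule act_act_inverse[OF _ h])
  have n1: "- int (n + 1) = - int n - 1" by simp
  have c: "range c \<subseteq> tree_vertices" "inj c" "ray_vertex (n + 1) \<notin> range c"
    using inj_ball_children[of 0 "- int n"] ball_parent_not_child[of 0 "- int n"]
    unfolding c_def ray_vertex_eq n1 by (auto simp del: pow_pi_uminus)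
  have "card A = CARD('a)"
    unfolding A_def using c inj by (simp add: card_image inj_on_subset)
  moreover have "nbrs V = insert (act g (ray_vertex (n + 1))) A"
    unfolding g(2) A_def nbrs_act[OF ray_vertex_in_tree g(1)] nbrs_ray c_def by simp
  moreover have "act g (ray_vertex (n + 1)) \<notin> A"
    unfolding A_def using inj_on_image_mem_iff[OF inj _ c(1)] c(3) by simp
  moreover have "height (act g (ray_vertex (n + 1))) = height V + 1"
    using g(1) by (simp add: height_act_ray n_def)
  moreover have "\<forall>w\<in>A. height w = (if n = 0 then 1 else n - 1)"
  proof
    fix w assume "w \<in> A"
    then obtain \<gamma> where w: "w = act g (c \<gamma>)" unfolding A_def by blast
    obtain k where k: "k \<in> GL2_polys" "c \<gamma> = act k (ray_vertex (if n = 0 then 1 else n - 1))"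
      using ray_child_orbit[of \<gamma> n] unfolding c_def by (elim bexE)
    have "height w = height (c \<gamma>)" unfolding w using c(1) by (intro height_act g(1)) blast
    then show "height w = (if n = 0 then 1 else n - 1)" unfolding k(2) height_act_ray[OF k(1)] .
  qed
  ultimately show ?thesis using that[of "act g (ray_vertex (n + 1))" A] unfolding n_def A_def by simp
qed


section \<open>Counting descendants\<close>

lemma Desc_0: "tree_adj x y \<Longrightarrow> Desc 0 (x, y) = {y}"
  unfolding Desc_def by (auto intro!: exI[of _ "\<lambda>i. if i = 0 then x else y"])

lemma Desc_Suc:
  assumes adj: "tree_adj x y"
  shows "Desc (Suc N) (x, y) = (\<Union>w \<in> nbrs y - {x}. Desc N (y, w))"
proof (intro equalityI subsetI)
  fix v assume "v \<in> Desc (Suc N) (x, y)"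
  then obtain z where z: "v = z (Suc N + 1)" "z 0 = x" "z 1 = y"
    and adj: "\<forall>i\<le>Suc N. tree_adj (z i) (z (i + 1))" and nb: "\<forall>i<Suc N. z i \<noteq> z (i + 2)"
    unfolding Desc_def fst_conv snd_conv by (elim CollectE exE conjE)
  have "tree_adj (z 1) (z (1 + 1))" using adj by (intro adj[rule_format]) simp
  moreover have "z 0 \<noteq> z (0 + 2)" by (intro nb[rule_format]) simp
  ultimately have "z 2 \<in> nbrs y - {x}" using z by (simp add: nbrs_def numeral_2_eq_2)
  moreover have "v \<in> Desc N (y, z 2)"
    unfolding Desc_def fst_conv snd_conv
  proof (intro CollectI exI[of _ "\<lambda>i. z (Suc i)"] conjI allI impI)
    fix i assume "i \<le> N" then show "tree_adj (z (Suc i)) (z (Suc (i + 1)))" using adj by simp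
  next
    fix i assume "i < N" then show "z (Suc i) \<noteq> z (Suc (i + 2))" using nb[rule_format, of "Suc i"] by simp
  qed (use z in \<open>simp_all add: numeral_2_eq_2\<close>)
  ultimately show "v \<in> (\<Union>w \<in> nbrs y - {x}. Desc N (y, w))" by (rule UN_I)
next
  fix v assume "v \<in> (\<Union>w \<in> nbrs y - {x}. Desc N (y, w))"
  then obtain w where w: "w \<in> nbrs y - {x}" "v \<in> Desc N (y, w)" by (elim UN_E)
  obtain z where z: "v = z (N + 1)" "z 0 = y" "z 1 = w"
    and adjz: "\<forall>i\<le>N. tree_adj (z i) (z (i + 1))" and nb: "\<forall>i<N. z i \<noteq> z (i + 2)"
    using w(2) unfolding Desc_def fst_conv snd_conv by (elim CollectE exE conjE)
  show "v \<in> Desc (Suc N) (x, y)"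
    unfolding Desc_def fst_conv snd_conv
    \<comment> \<open>the path \<open>z\<close> with \<open>x\<close> put in front\<close>
  proof (intro CollectI exI[of _ "\<lambda>i. case i of 0 \<Rightarrow> x | Suc i \<Rightarrow> z i"] conjI allI impI)
    fix i assume "i \<le> Suc N"
    then show "tree_adj (case i of 0 \<Rightarrow> x | Suc i \<Rightarrow> z i) (case i + 1 of 0 \<Rightarrow> x | Suc i \<Rightarrow> z i)"
      using adj adjz z by (cases i) auto
  next
    fix i assume "i < Suc N"
    then show "(case i of 0 \<Rightarrow> x | Suc i \<Rightarrow> z i) \<noteq> (case i + 2 of 0 \<Rightarrow> x | Suc i \<Rightarrow> z i)"
      using nb w(1) z by (cases i) auto
  qed (use z in simp_all)
qed

lemma in_nbrs_iff: "W \<in> nbrs V \<longleftrightarrow> tree_adj V W"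
  by (simp add: nbrs_def)

lemma finite_nbrs: "V \<in> tree_vertices \<Longrightarrow> finite (nbrs V)"
  by (erule nbrs_heights) simp

lemma finite_Desc: "tree_adj x y \<Longrightarrow> finite (Desc N (x, y))"
proof (induction N arbitrary: x y)
  case (Suc N)
  then have "finite (nbrs y)" by (intro finite_nbrs) (simp add: tree_adj_def)
  then show ?case using Suc by (simp add: Desc_Suc in_nbrs_iff)
qed (simp add: Desc_0)

text \<open>
  Equality holds only for paths that descend all the way. This separates the descendants through a child
  from those through the parent.
\<close>

lemma level_Desc_le: "tree_adj x y \<Longrightarrow> v \<in> Desc N (x, y) \<Longrightarrow> level v \<le> level y + int N"
proof (induction N arbitrary: x y)
  case (Suc N)
  obtain w where w: "w \<in> nbrs y - {x}" "v \<in> Desc N (y, w)"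
    using Suc.prems(2) unfolding Desc_Suc[OF Suc.prems(1)] by (elim UN_E)
  then have adj: "tree_adj y w" by (simp add: in_nbrs_iff)
  then have "level v \<le> level w + int N" using w(2) by (rule Suc.IH)
  moreover have "level w \<le> level y + 1" using tree_adj_levels[OF adj] by auto
  ultimately show ?case by simp
qed (simp add: Desc_0)

text \<open>
  After a step away from the parent a path can only continue to children, because going up again would
  backtrack. So \<open>y\<close> is an ancestor of every vertex that such a path reaches.
\<close>

lemma parent_Desc_descending:
  "tree_adj x y \<Longrightarrow> parent y = x \<Longrightarrow> v \<in> Desc N (x, y) \<Longrightarrow>
    level v = level y + int N \<and> (parent ^^ N) v = y"
proof (induction N arbitrary: x y)
  case (Suc N)
  obtain w where w: "w \<in> nbrs y - {x}" "v \<in> Desc N (y, w)"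
    using Suc.prems(3) unfolding Desc_Suc[OF Suc.prems(1)] by (elim UN_E)
  then have adj: "tree_adj y w" by (simp add: in_nbrs_iff)
  have "parent w = y" "level w = level y + 1"
    using tree_adj_levels[OF adj] w(1) Suc.prems(2) by auto
  then show ?case using Suc.IH[OF adj _ w(2)] by simp
qed (simp add: Desc_0)

text \<open>
  Of two different neighbours at least one is a child. Descendants through two children have different
  ancestors \<open>N\<close> steps above; those through a child and the parent have different levels.
\<close>

lemma Desc_disjoint:
  assumes w: "tree_adj y w" "tree_adj y w'" "w \<noteq> w'"
  shows "Desc N (y, w) \<inter> Desc N (y, w') = {}"
proof -
  have up: "Desc N (y, u) \<inter> Desc N (y, u') = {}"
    if u: "tree_adj y u" "tree_adj y u'" "parent u = y" "level u = level y + 1" "u \<noteq> u'" for u u'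
  proof (rule ccontr)
    assume "Desc N (y, u) \<inter> Desc N (y, u') \<noteq> {}"
    then obtain v where v: "v \<in> Desc N (y, u)" "v \<in> Desc N (y, u')" by auto
    have 1: "level v = level u + int N" "(parent ^^ N) v = u"
      using parent_Desc_descending[OF u(1,3) v(1)] by simp_all
    have 2: "level v \<le> level u' + int N" by (rule level_Desc_le[OF u(2) v(2)])
    then have "parent u' = y" using tree_adj_levels[OF u(2)] 1 u(4) by auto
    then have "(parent ^^ N) v = u'" using parent_Desc_descending[OF u(2) _ v(2)] by simp
    then show False using 1 u(5) by simp
  qed
  consider "parent w = y" "level w = level y + 1" | "parent w' = y" "level w' = level y + 1"
    using tree_adj_levels[OF w(1)] tree_adj_levels[OF w(2)] w(3) by metis
  then show ?thesis
  proof cases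
    case 1 then show ?thesis using up[OF w(1,2)] w(3) by simp
  next
    case 2 then show ?thesis using up[OF w(2,1)] w(3) by (simp add: Int_commute)
  qed
qed

definition height_count :: "nat \<Rightarrow> 'a::{field,finite} vert \<times> 'a vert \<Rightarrow> nat \<Rightarrow> nat" where
  "height_count N e j = card {v \<in> Desc N e. height v = j}"

lemma height_count_Suc:
  assumes "tree_adj x y"
  shows "height_count (Suc N) (x, y) j = (\<Sum>w \<in> nbrs y - {x}. height_count N (y, w) j)"
proof -
  have "y \<in> tree_vertices" using assms by (simp add: tree_adj_def)
  then have fin: "finite (nbrs y - {x})" using finite_nbrs by blast
  have "{v \<in> Desc (Suc N) (x, y). height v = j} =
      (\<Union>w \<in> nbrs y - {x}. {v \<in> Desc N (y, w). height v = j})"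
    unfolding Desc_Suc[OF assms] by auto
  also have "card \<dots> = (\<Sum>w \<in> nbrs y - {x}. card {v \<in> Desc N (y, w). height v = j})"
  proof (rule card_UN_disjoint[OF fin])
    show "\<forall>w\<in>nbrs y - {x}. finite {v \<in> Desc N (y, w). height v = j}"
      by (simp add: finite_Desc in_nbrs_iff)
    show "\<forall>w\<in>nbrs y - {x}. \<forall>w'\<in>nbrs y - {x}. w \<noteq> w' \<longrightarrow>
        {v \<in> Desc N (y, w). height v = j} \<inter> {v \<in> Desc N (y, w'). height v = j} = {}"
    proof (intro ballI impI)
      fix w w' assume "w \<in> nbrs y - {x}" "w' \<in> nbrs y - {x}" "w \<noteq> w'"
      then have "Desc N (y, w) \<inter> Desc N (y, w') = {}" by (intro Desc_disjoint) (simp_all add: in_nbrs_iff)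
      then show "{v \<in> Desc N (y, w). height v = j} \<inter> {v \<in> Desc N (y, w'). height v = j} = {}"
        by (simp add: disjoint_iff)
    qed
  qed
  finally show ?thesis by (simp add: height_count_def)
qed

section \<open>The Markov chain on states\<close>

text \<open>
  The height process of a random non-backtracking path, started in state \<open>(\<epsilon>, k)\<close>: the probability
  of being at height \<open>j\<close> after \<open>N\<close> steps. A backward path keeps descending to height \<open>0\<close>, where
  it is forced to turn; a forward path goes on with probability \<open>1 / q\<close> and turns otherwise.
\<close>

fun walk :: "real \<Rightarrow> direction \<Rightarrow> nat \<Rightarrow> nat \<Rightarrow> nat \<Rightarrow> real" where
  "walk q \<epsilon> k 0 j = of_bool (j = k)"
| "walk q Fwd k (Suc N) j = walk q Fwd (k + 1) N j / q + (1 - 1 / q) * walk q Bwd (k - 1) N j"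
| "walk q Bwd 0 (Suc N) j = walk q Fwd 1 N j"
| "walk q Bwd (Suc k) (Suc N) j = walk q Bwd k N j"

text \<open>
  Removing the vertex \<open>x\<close> that the path came from, one of the \<open>q + 1\<close> neighbours of \<open>y\<close>, leaves
  \<open>u\<close> and \<open>q - 1\<close> vertices of \<open>A\<close> in a forward state and the set \<open>A\<close> in a backward state of
  positive height. At height \<open>0\<close> any \<open>q\<close> of the neighbours will do.
\<close>

lemma height_count_eq_walk:
  fixes e :: "'a::{field,finite} vert \<times> 'a vert"
  assumes "in_state e \<epsilon> k"
  shows "real (height_count N e j) = real CARD('a) ^ N * walk (real CARD('a)) \<epsilon> k N j"
  using assms
proof (induction N arbitrary: e \<epsilon> k)
  case 0
  obtain x y where e: "e = (x, y)" by (cases e)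
  have "{v. v = y \<and> height v = j} = (if height y = j then {y} else {})" by auto
  then show ?case using 0 by (auto simp: e in_state_def height_count_def Desc_0)
next
  case (Suc N)
  let ?q = "real CARD('a)" let ?W = "walk (real CARD('a))"
  have q: "?q > 0" "CARD('a) \<ge> 1" by (simp_all add: Suc_leI)
  obtain x y where e: "e = (x, y)" by (cases e)
  have adj: "tree_adj x y" and k: "height y = k" using Suc.prems by (simp_all add: e in_state_def)
  have y: "y \<in> tree_vertices" using adj by (simp add: tree_adj_def)
  have x: "x \<in> nbrs y" using adj tree_adj_sym[of x y] by (simp add: in_nbrs_iff)
  obtain u A where nb: "nbrs y = insert u A" "u \<notin> A" "finite A" "card A = CARD('a)"
    "height u = k + 1" "\<forall>w\<in>A. height w = (if k = 0 then 1 else k - 1)"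
    using nbrs_heights[OF y] unfolding k by metis
  have fwd: "real (height_count N (y, w) j) = ?q ^ N * ?W Fwd (k + 1) N j"
    if "w \<in> nbrs y" "height w = k + 1" for w
    by (rule Suc.IH) (use that k in \<open>simp add: in_state_def in_nbrs_iff\<close>)
  have bwd: "real (height_count N (y, w) j) = ?q ^ N * ?W Bwd (k - 1) N j"
    if "w \<in> nbrs y" "height w = k - 1" "k \<noteq> 0" for w
    by (rule Suc.IH) (use that k in \<open>simp add: in_state_def in_nbrs_iff\<close>)
  have step: "real (height_count (Suc N) e j) =
      (\<Sum>w \<in> nbrs y - {x}. real (height_count N (y, w) j))"
    unfolding e height_count_Suc[OF adj] by simp
  have cardN: "card (nbrs y - {x}) = CARD('a)"
    using x nb by (simp add: card_insert_if)
  show ?case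
  proof (cases \<epsilon>)
    case Fwd
    then have hx: "k \<ge> 1" "height x = k - 1" using Suc.prems by (simp_all add: e in_state_def)
    then have xA: "x \<in> A" "x \<noteq> u" using x nb by auto
    then have "nbrs y - {x} = insert u (A - {x})" using nb by auto
    then have "real (height_count (Suc N) e j) =
        real (height_count N (y, u) j) + (\<Sum>w \<in> A - {x}. real (height_count N (y, w) j))"
      unfolding step using nb by simp
    also have "(\<Sum>w \<in> A - {x}. real (height_count N (y, w) j)) = (\<Sum>w \<in> A - {x}. ?q ^ N * ?W Bwd (k - 1) N j)"
      using hx(1) nb by (intro sum.cong refl bwd) auto
    also have "\<dots> = (?q - 1) * (?q ^ N * ?W Bwd (k - 1) N j)"
      using xA nb q(2) by (simp add: of_nat_diff)
    also have "real (height_count N (y, u) j) = ?q ^ N * ?W Fwd (k + 1) N j"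
      using nb by (intro fwd) auto
    also have "?q ^ N * ?W Fwd (k + 1) N j + (?q - 1) * (?q ^ N * ?W Bwd (k - 1) N j) =
        ?q ^ Suc N * (?W Fwd (k + 1) N j / ?q + (1 - 1 / ?q) * ?W Bwd (k - 1) N j)"
      using q(1) by (simp add: algebra_simps)
    finally show ?thesis unfolding Fwd walk.simps .
  next
    case Bwd
    then have hx: "height x = k + 1" using Suc.prems by (simp add: e in_state_def)
    show ?thesis
    proof (cases k)
      case 0
      have "(\<Sum>w \<in> nbrs y - {x}. real (height_count N (y, w) j)) =
          (\<Sum>w \<in> nbrs y - {x}. ?q ^ N * ?W Fwd 1 N j)"
        using fwd nb 0 by (intro sum.cong refl) auto
      then show ?thesis unfolding step using Bwd 0 cardN by simp
    next
      case (Suc k')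
      then have "x = u" using x nb hx by auto
      then have "nbrs y - {x} = A" using nb by auto
      then have "(\<Sum>w \<in> nbrs y - {x}. real (height_count N (y, w) j)) = (\<Sum>w \<in> A. ?q ^ N * ?W Bwd k' N j)"
        using Suc nb bwd by (intro sum.cong) auto
      then show ?thesis unfolding step using Bwd Suc nb by simp
    qed
  qed
qed

lemma in_state_exists:
  assumes "\<epsilon> = Fwd \<longrightarrow> k \<ge> 1"
  shows "\<exists>e :: 'a::{field,finite} vert \<times> 'a vert. in_state e \<epsilon> k"
proof -
  have up: "tree_adj (ray_vertex n) (ray_vertex (n + 1))" for n
    by (simp add: nbrs_ray flip: in_nbrs_iff)
  show ?thesis
  proof (cases \<epsilon>)
    case Fwd
    then show ?thesis using assms up[of "k - 1"]
      by (intro exI[of _ "(ray_vertex (k - 1), ray_vertex k)"]) (simp add: in_state_def)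
  next
    case Bwd
    have "tree_adj (ray_vertex (k + 1)) (ray_vertex k :: 'a vert)"
      using up[of k] tree_adj_sym by blast
    then show ?thesis using Bwd
      by (intro exI[of _ "(ray_vertex (k + 1), ray_vertex k)"]) (simp add: in_state_def)
  qed
qed

lemma mu_eq_walk:
  assumes "\<epsilon> = Fwd \<longrightarrow> k \<ge> 1"
  shows "mu TYPE('a::{field,finite}) \<epsilon> k N j = walk (real CARD('a)) \<epsilon> k N j"
proof -
  have *: "real (card {v \<in> Desc N e. height v = j}) / real CARD('a) ^ N = walk (real CARD('a)) \<epsilon> k N j"
    if "in_state e \<epsilon> k" for e :: "'a vert \<times> 'a vert"
    using height_count_eq_walk[OF that, of N j] by (simp add: height_count_def)
  obtain e :: "'a vert \<times> 'a vert" where e: "in_state e \<epsilon> k" using in_state_exists[OF assms] by (elim exE)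
  show ?thesis unfolding mu_def
  proof (rule the_equality)
    fix r
    assume r: "\<forall>e :: 'a vert \<times> 'a vert. in_state e \<epsilon> k \<longrightarrow>
      r = real (card {v \<in> Desc N e. height v = j}) / real CARD('a) ^ N"
    have "r = real (card {v \<in> Desc N e. height v = j}) / real CARD('a) ^ N"
      by (rule r[rule_format, OF e])
    then show "r = walk (real CARD('a)) \<epsilon> k N j" using *[OF e] by (rule trans)
  qed (intro allI impI, rule *[symmetric])
qed

section \<open>Convergence of the height law\<close>

text \<open>
  A path that turns at the first step has a law that depends only on \<open>N - k\<close>, so in the difference
  between \<open>(k + 1, N + 1)\<close> and \<open>(k, N)\<close> these contributions cancel. Only the paths that go straight
  up to height \<open>k + N\<close>, of probability \<open>q\<^bsup>-N\<^esup>\<close>, remain; there the extra step splits the mass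
  between the heights \<open>k + N + 2\<close> and \<open>k + N\<close>.
\<close>

lemma walk_shift:
  assumes "k \<ge> 1"
  shows "walk q Fwd (k + 1) (N + 1) j =
    walk q Fwd k N j + (1 / q) ^ (N + 1) * (of_bool (j = k + N + 2) - of_bool (j = k + N))"
  using assms
proof (induction N arbitrary: k)
  case 0
  then show ?case by (cases k) (simp_all add: algebra_simps)
next
  case (Suc N)
  obtain k' where k: "k = Suc k'" using Suc.prems by (cases k) auto
  have "walk q Fwd (k + 1) (Suc N + 1) j - walk q Fwd k (Suc N) j =
      (walk q Fwd (k + 1 + 1) (N + 1) j - walk q Fwd (k + 1) N j) / q"
    by (simp add: k diff_divide_distrib)
  also have "\<dots> = (1 / q) ^ (Suc N + 1) * (of_bool (j = k + Suc N + 2) - of_bool (j = k + Suc N))"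
    using Suc.IH[of "k + 1"] by (simp add: add_ac)
  finally show ?case by simp
qed

lemma walk_Bwd_descend: "k \<le> N \<Longrightarrow> walk q Bwd k N j = walk q Bwd 0 (N - k) j"
proof (induction k arbitrary: N)
  case (Suc k) then show ?case by (cases N) simp_all
qed simp

text \<open>
  The backward law at height \<open>0\<close> is the forward law at height \<open>1\<close> one step later, so the first step
  relates it to itself and to a forward law at height \<open>2\<close>, which \<open>walk_shift\<close> brings back to height
  \<open>1\<close>.
\<close>

lemma walk_Bwd_step:
  "walk q Bwd 0 (M + 2) j =
    walk q Bwd 0 M j + (1 / q) ^ (M + 1) * (of_bool (j = M + 2) - of_bool (j = M))"
proof (cases M)
  case 0 then show ?thesis by (simp add: numeral_2_eq_2 algebra_simps)
next
  case (Suc M')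
  have "walk q Bwd 0 (M + 2) j = walk q Fwd (1 + 1) (M' + 1) j / q + (1 - 1 / q) * walk q Bwd 0 M j"
    by (simp add: Suc)
  also have "\<dots> = walk q Bwd 0 M j + (1 / q) ^ (M + 1) * (of_bool (j = M + 2) - of_bool (j = M))"
    unfolding walk_shift[OF order_refl] by (simp add: Suc algebra_simps add_divide_distrib diff_divide_distrib)
  finally show ?thesis .
qed

lemma rho_ev_eq:
  assumes "q > 0"
  shows "rho_ev q j = (if odd j then 0 else (1 / real q) ^ j *
    (if j = 0 then 1 - 1 / real q else real q - 1 / real q))"
proof -
  have "real q powi (- int j - 1) = (1 / real q) ^ j / real q"
    using assms by (simp add: power_int_diff power_int_minus power_one_over inverse_eq_divide)
  then show ?thesis using assms by (auto simp: rho_ev_def field_simps power2_eq_square)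
qed

text \<open>
  The increments of \<open>walk_Bwd_step\<close> telescope: a positive even height \<open>j\<close> gains \<open>q\<^bsup>1-j\<^esup>\<close> when \<open>M\<close>
  reaches it and loses \<open>q\<^bsup>-j-1\<^esup>\<close> at the next step, after which it has exactly its limit value.
\<close>

lemma walk_Bwd_0_eq:
  assumes "q > 0" "even M"
  shows "walk (real q) Bwd 0 M j = (if j < M then rho_ev q j
    else if j = M then (1 / real q) ^ M * (if M = 0 then 1 else real q) else 0)"
  using assms(2)
proof (induction M rule: nat_induct2)
  case (step M)
  have M: "even M" "M = 0 \<or> M \<ge> 2" using step.prems by presburger+
  have *: "walk (real q) Bwd 0 (M + 2) j =
      (if j < M then rho_ev q j
       else if j = M then (1 / real q) ^ M * (if M = 0 then 1 else real q) else 0)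
      + (1 / real q) ^ (M + 1) * (of_bool (j = M + 2) - of_bool (j = M))"
    unfolding walk_Bwd_step step.IH[OF M(1)] ..
  consider "j < M" | "j = M" | "j = Suc M" | "j = M + 2" | "j > M + 2" by linarith
  then show ?case unfolding *
    by cases (use M assms(1) in \<open>auto simp: rho_ev_eq algebra_simps\<close>)
qed auto

lemma tv_norm_triangle:
  "tv_norm (\<lambda>j. f j - h j) \<le> tv_norm (\<lambda>j. f j - g j) + tv_norm (\<lambda>j. g j - h j)"
proof -
  have "tv_norm (\<lambda>j. f j - h j) \<le> (\<Sum>j. ennreal \<bar>f j - g j\<bar> + ennreal \<bar>g j - h j\<bar>)"
    unfolding tv_norm_def by (intro suminf_le) (auto simp flip: ennreal_plus intro!: ennreal_leI)
  then show ?thesis by (simp add: tv_norm_def suminf_add)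
qed

lemma tv_norm_two_points: "tv_norm (\<lambda>j. c * (of_bool (j = a) - of_bool (j = b))) \<le> ennreal (2 * \<bar>c\<bar>)"
proof -
  have 1: "(\<Sum>j. ennreal (\<bar>c\<bar> * of_bool (j = i))) = ennreal \<bar>c\<bar>" for i :: nat
    by (subst suminf_finite[where N = "{i}"]) auto
  have "tv_norm (\<lambda>j. c * (of_bool (j = a) - of_bool (j = b))) \<le>
      (\<Sum>j. ennreal (\<bar>c\<bar> * of_bool (j = a)) + ennreal (\<bar>c\<bar> * of_bool (j = b)))"
    unfolding tv_norm_def by (intro suminf_le) (auto simp flip: ennreal_plus)
  also have "\<dots> = ennreal \<bar>c\<bar> + ennreal \<bar>c\<bar>" by (subst suminf_add[symmetric]) (simp_all only: 1 summableI)
  finally show ?thesis by (simp flip: ennreal_plus)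
qed

lemma tv_norm_geometric:
  assumes r: "0 \<le> r" "r < 1" and c: "0 \<le> c"
    and bound: "\<And>j. \<bar>f j\<bar> \<le> (if j < M then 0 else c * r ^ j)"
  shows "tv_norm f \<le> ennreal (c * r ^ M / (1 - r))"
proof -
  let ?g = "\<lambda>j. if j < M then 0 else c * r ^ j"
  have "(\<lambda>i. ?g (i + M)) sums (c * r ^ M * (1 / (1 - r)))"
    using sums_mult[OF geometric_sums[of r], of "c * r ^ M"] r by (simp add: power_add mult_ac)
  then have g: "?g sums (c * r ^ M / (1 - r))" by (subst (asm) sums_zero_iff_shift) auto
  have "tv_norm f \<le> (\<Sum>j. ennreal (?g j))"
    unfolding tv_norm_def by (intro suminf_le ennreal_leI bound) auto
  also have "\<dots> = ennreal (\<Sum>j. ?g j)"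
    using g r c by (intro suminf_ennreal2) (auto simp: sums_iff)
  also have "\<dots> = ennreal (c * r ^ M / (1 - r))" using g by (simp add: sums_iff)
  finally show ?thesis .
qed

text \<open>
  Below \<open>M\<close> the law and its limit agree, and from \<open>M\<close> on both lie between \<open>0\<close> and
  \<open>q\<^bsup>1-j\<^esup>\<close>; the distance is a geometric tail.
\<close>

lemma tv_walk_Bwd_0:
  assumes q: "q \<ge> 2" and "even M"
  shows "tv_norm (\<lambda>j. walk (real q) Bwd 0 M j - rho_ev q j) \<le> ennreal (2 * real q * (1 / real q) ^ M)"
proof -
  let ?q = "real q"
  have qq: "1 \<le> ?q * ?q" "?q \<le> 1 + ?q * ?q"
  proof -
    have "1 * ?q \<le> ?q * ?q" using q by (intro mult_right_mono) auto
    then show "1 \<le> ?q * ?q" "?q \<le> 1 + ?q * ?q" using q by linarith+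
  qed
  have rho: "0 \<le> rho_ev q j" "rho_ev q j \<le> ?q * (1 / ?q) ^ j" for j
    using q qq by (auto simp: rho_ev_eq field_simps)
  have "\<bar>walk ?q Bwd 0 M j - rho_ev q j\<bar> \<le> (if j < M then 0 else ?q * (1 / ?q) ^ j)" for j
  proof -
    have "0 \<le> walk ?q Bwd 0 M j" "walk ?q Bwd 0 M j \<le> ?q * (1 / ?q) ^ j"
      using q assms(2) rho[of j] by (auto simp: walk_Bwd_0_eq)
    moreover have "walk ?q Bwd 0 M j = rho_ev q j" if "j < M"
      using q assms(2) that by (simp add: walk_Bwd_0_eq)
    ultimately show ?thesis using rho[of j] by (cases "j < M") (simp_all add: abs_le_iff)
  qed
  then have "tv_norm (\<lambda>j. walk ?q Bwd 0 M j - rho_ev q j) \<le> ennreal (?q * (1 / ?q) ^ M / (1 - 1 / ?q))"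
    using q by (intro tv_norm_geometric) auto
  also have "\<dots> \<le> ennreal (2 * ?q * (1 / ?q) ^ M)"
  proof (rule ennreal_leI)
    have "1 / (1 - 1 / ?q) \<le> 2" using q by (simp add: field_simps)
    then have "?q * (1 / ?q) ^ M * (1 / (1 - 1 / ?q)) \<le> ?q * (1 / ?q) ^ M * 2"
      by (intro mult_left_mono) auto
    then show "?q * (1 / ?q) ^ M / (1 - 1 / ?q) \<le> 2 * ?q * (1 / ?q) ^ M" by simp
  qed
  finally show ?thesis .
qed

text \<open>
  Induction on the height along \<open>walk_shift\<close>, starting from height \<open>1\<close>, where the forward law is a
  backward law. Each step costs at most twice the mass \<open>q\<^bsup>-M-k-2\<^esup>\<close>. The term
  \<open>- 2 q\<^bsup>-k\<^esup>\<close> in the constant absorbs these costs, because \<open>q \<ge> 2\<close>.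
\<close>

lemma tv_walk_Fwd:
  assumes q: "q \<ge> 2" and "even M"
  shows "tv_norm (\<lambda>j. walk (real q) Fwd (Suc k) (M + Suc k) j - rho_ev q j)
    \<le> ennreal ((2 * real q + 2 - 2 * (1 / real q) ^ k) * (1 / real q) ^ M)"
proof (induction k)
  case 0
  have "tv_norm (\<lambda>j. walk (real q) Fwd (Suc 0) (M + Suc 0) j - rho_ev q j) \<le>
      ennreal (2 * real q * (1 / real q) ^ (M + 2))"
    using tv_walk_Bwd_0[of q "M + 2"] assms by simp
  also have "\<dots> \<le> ennreal (2 * real q * (1 / real q) ^ M)"
    using q by (intro ennreal_leI mult_left_mono power_decreasing) auto
  finally show ?case by simp
next
  case (Suc k)
  let ?r = "1 / real q"
  have "tv_norm (\<lambda>j. walk (real q) Fwd (Suc (Suc k)) (M + Suc (Suc k)) j - walk (real q) Fwd (Suc k) (M + Suc k) j)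
      = tv_norm (\<lambda>j. ?r ^ (M + Suc k + 1) * (of_bool (j = Suc k + (M + Suc k) + 2) - of_bool (j = Suc k + (M + Suc k))))"
    using walk_shift[of "Suc k" "real q" "M + Suc k"] by simp
  also have "\<dots> \<le> ennreal (2 * \<bar>?r ^ (M + Suc k + 1)\<bar>)" by (rule tv_norm_two_points)
  finally have "tv_norm (\<lambda>j. walk (real q) Fwd (Suc (Suc k)) (M + Suc (Suc k)) j - rho_ev q j) \<le>
      ennreal (2 * \<bar>?r ^ (M + Suc k + 1)\<bar>) + ennreal ((2 * real q + 2 - 2 * ?r ^ k) * ?r ^ M)"
    by (rule order_trans[OF tv_norm_triangle add_mono[OF _ Suc.IH]])
  also have "\<dots> = ennreal (2 * \<bar>?r ^ (M + Suc k + 1)\<bar> + (2 * real q + 2 - 2 * ?r ^ k) * ?r ^ M)"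
    using q power_le_one[of ?r k] by (intro ennreal_plus[symmetric] mult_nonneg_nonneg) auto
  also have "\<dots> \<le> ennreal ((2 * real q + 2 - 2 * ?r ^ Suc k) * ?r ^ M)"
  proof (rule ennreal_leI)
    have r: "0 \<le> ?r" "?r \<le> 1 / 2" "?r \<le> 1" using q by (auto simp: field_simps)
    have "?r ^ (Suc k) \<le> ?r ^ k / 2" using r mult_right_mono[OF r(2), of "?r ^ k"] by simp
    moreover have "?r ^ (Suc k + 1) \<le> ?r ^ Suc k" using r by (intro power_decreasing) auto
    ultimately have "2 * ?r ^ (Suc k + 1) + (2 * real q + 2 - 2 * ?r ^ k) \<le> 2 * real q + 2 - 2 * ?r ^ Suc k"
      by linarith
    then have "(2 * ?r ^ (Suc k + 1) + (2 * real q + 2 - 2 * ?r ^ k)) * ?r ^ M \<le> (2 * real q + 2 - 2 * ?r ^ Suc k) * ?r ^ M"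
      using r by (intro mult_right_mono) auto
    moreover have "2 * \<bar>?r ^ (M + Suc k + 1)\<bar> = 2 * ?r ^ (Suc k + 1) * ?r ^ M"
      using r by (simp add: power_add mult_ac)
    ultimately show "2 * \<bar>?r ^ (M + Suc k + 1)\<bar> + (2 * real q + 2 - 2 * ?r ^ k) * ?r ^ M
        \<le> (2 * real q + 2 - 2 * ?r ^ Suc k) * ?r ^ M" by (simp only: distrib_right)
  qed
  finally show ?case .
qed

lemma tv_mu_bound:
  assumes "even (k + N)" "\<epsilon> = Fwd \<longrightarrow> k \<ge> 1" "k \<le> N"
  shows "tv_norm (\<lambda>j. mu TYPE('a::{field,finite}) \<epsilon> k N j - rho_ev CARD('a) j)
    \<le> ennreal ((2 * real CARD('a) + 2) * real CARD('a) powr (- (real N - real k)))"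
proof -
  let ?q = "real CARD('a)" and ?M = "N - k"
  have "card {0, 1 :: 'a} \<le> CARD('a)" by (rule card_mono) auto
  then have q: "CARD('a) \<ge> 2" by simp
  have M: "even ?M" using assms(1,3) by auto
  have "?q powr (- (real N - real k)) = (1 / ?q) ^ ?M"
    using assms(3) by (simp add: powr_minus powr_realpow power_one_over inverse_eq_divide flip: of_nat_diff)
  moreover have "tv_norm (\<lambda>j. walk ?q \<epsilon> k N j - rho_ev CARD('a) j)
      \<le> ennreal ((2 * ?q + 2) * (1 / ?q) ^ ?M)"
  proof (cases \<epsilon>)
    case Fwd
    then obtain k' where k': "k = Suc k'" using assms(2) by (cases k) auto
    have "tv_norm (\<lambda>j. walk ?q \<epsilon> k N j - rho_ev CARD('a) j)
        \<le> ennreal ((2 * ?q + 2 - 2 * (1 / ?q) ^ k') * (1 / ?q) ^ ?M)"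
      using tv_walk_Fwd[OF q M, of k'] Fwd k' assms(3) by simp
    also have "\<dots> \<le> ennreal ((2 * ?q + 2) * (1 / ?q) ^ ?M)"
      by (intro ennreal_leI mult_right_mono) auto
    finally show ?thesis .
  next
    case Bwd
    have "tv_norm (\<lambda>j. walk ?q \<epsilon> k N j - rho_ev CARD('a) j) \<le> ennreal (2 * ?q * (1 / ?q) ^ ?M)"
      using tv_walk_Bwd_0[OF q M] unfolding Bwd walk_Bwd_descend[OF assms(3)] .
    also have "\<dots> \<le> ennreal ((2 * ?q + 2) * (1 / ?q) ^ ?M)"
      by (intro ennreal_leI mult_right_mono) auto
    finally show ?thesis .
  qed
  ultimately show ?thesis by (simp only: mu_eq_walk[OF assms(2)])
qed

theorem proposition3p16:
  shows "(\<exists>C::real. C \<ge> 0 \<and> (\<forall>(N::nat) (\<epsilon>::direction) (k::nat).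
            even (k + N) \<longrightarrow> (\<epsilon> = Fwd \<longrightarrow> k \<ge> 1) \<longrightarrow> k \<le> N \<longrightarrow>
            tv_norm (\<lambda>j. mu TYPE('a::{field,finite}) \<epsilon> k N j - rho_ev CARD('a) j)
              \<le> ennreal (C * real CARD('a) powr (- (real N - real k) / 2))))
       \<and> (\<exists>C::real. C \<ge> 0 \<and> (\<forall>(N::nat) (k::nat).
            even (k + N) \<longrightarrow> k \<le> N \<longrightarrow>
            tv_norm (\<lambda>j. mu TYPE('a) Bwd k N j - rho_ev CARD('a) j)
              \<le> ennreal (C * real CARD('a) powr (- (real N - real k)))))"
proof (intro conjI exI[of _ "2 * real CARD('a) + 2"] allI impI)
  fix N k :: nat and \<epsilon> :: direction
  assume *: "even (k + N)" "\<epsilon> = Fwd \<longrightarrow> k \<ge> 1" "k \<le> N"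
  have "tv_norm (\<lambda>j. mu TYPE('a) \<epsilon> k N j - rho_ev CARD('a) j)
      \<le> ennreal ((2 * real CARD('a) + 2) * real CARD('a) powr (- (real N - real k)))"
    using * by (intro tv_mu_bound) auto
  also have "\<dots> \<le> ennreal ((2 * real CARD('a) + 2) * real CARD('a) powr (- (real N - real k) / 2))"
    using *(3) by (intro ennreal_leI mult_left_mono powr_mono) (auto simp: Suc_leI)
  finally show "tv_norm (\<lambda>j. mu TYPE('a) \<epsilon> k N j - rho_ev CARD('a) j)
      \<le> ennreal ((2 * real CARD('a) + 2) * real CARD('a) powr (- (real N - real k) / 2))" .
next
  fix N k :: nat
  assume "even (k + N)" "k \<le> N"
  then show "tv_norm (\<lambda>j. mu TYPE('a) Bwd k N j - rho_ev CARD('a) j)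
      \<le> ennreal ((2 * real CARD('a) + 2) * real CARD('a) powr (- (real N - real k)))"
    by (intro tv_mu_bound) auto
qed auto

end
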